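(* Let $\delta>0$, let $N\ge1$ be an integer and let $\nu$ be given by $2\nu+2=N$. Let $\{a_j\}_{j=1}^M$ be a sequence of complex numbers and $\{\mathbf{y}_j\}_{j=1}^M$ a sequence of vectors in $\mathbb{R}^N$ with $|\mathbf{y}_j-\mathbf{y}_l|\ge\delta$ for any $j\ne l$. For a nonnegative Borel measure $\mu$ on $(0,\infty)$ define $$\mathcal{Q}_\mu(\mathbf{y})=\int_0^\infty\lambda^{-N/2}\,e^{-\pi|\mathbf{y}|^2/\lambda}\,d\mu(\lambda).$$ (i) If $\mu$ satisfies $\int_0^\infty\frac{\lambda^k}{1+\lambda^{\nu+k+1}}\,d\mu(\lambda)<\infty$ for some $k\in\mathbb{N}$, then $$-U_\nu^{N-}(2\pi\delta,\mu)\sum_{j=1}^M|a_j|^2\ \le\ \sum_{\substack{j,l=1\\ j\ne l}}^M a_j\overline{a_l}\,\mathcal{Q}_\mu(\mathbf{y}_j-\mathbf{y}_l).$$ (ii) If $\mu$ satisfies $\int_0^\infty\frac{\lambda^k}{1+\lambda^{k}}\,d\mu(\lambda)<\infty$ for some $k\in\mathbb{N}$, then $$\sum_{\substack{j,l=1\\ j\ne l}}^M a_j\overline{a_l}\,\mathcal{Q}_\mu(\mathbf{y}_j-\mathbf{y}_l)\ \le\ U_\nu^{N+}(2\pi\delta,\mu)\sum_{j=1}^M|a_j|^2.$$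
   Context: Here $U_\nu^{N\pm}(\delta,\mu)=\int_0^\infty U_\nu^{N\pm}(\delta,\lambda)\,d\mu(\lambda)$, where for $\lambda>0$ and $\delta>0$ $$U_\nu^{N-}(\delta,\lambda)=\inf_{\mathcal{L}}\int_{\mathbb{R}^N}\big\{e^{-\pi\lambda|\mathbf{x}|^2}-\mathcal{L}(\mathbf{x})\big\}|\mathbf{x}|^{2\nu+2-N}d\mathbf{x},\qquad U_\nu^{N+}(\delta,\lambda)=\inf_{\mathcal{M}}\int_{\mathbb{R}^N}\big\{\mathcal{M}(\mathbf{x})-e^{-\pi\lambda|\mathbf{x}|^2}\big\}|\mathbf{x}|^{2\nu+2-N}d\mathbf{x},$$ the infima being over entire functions $\mathcal{L}$ (resp. $\mathcal{M}$) on $\mathbb{C}^N$ of exponential type at most $\delta$ that are real-valued on $\mathbb{R}^N$ with $\mathcal{L}(\mathbf{x})\le e^{-\pi\lambda|\mathbf{x}|^2}$ (resp. $\mathcal{M}(\mathbf{x})\ge e^{-\pi\lambda|\mathbf{x}|^2}$) for all $\mathbf{x}\in\mathbb{R}^N$. (When $2\nu+2=N$ the weight $|\mathbf{x}|^{2\nu+2-N}$ equals $1$.) An entire $F:\mathbb{C}^N\to\mathbb{C}$, not identically zero, has exponential type $\tau(F)=\limsup_{\|\mathbf{z}\|\to\infty}\|\mathbf{z}\|^{-1}\log|F(\mathbf{z})|$ (when finite), with $\|\mathbf{z}\|=\sup\{|\sum_n z_nt_n|:\mathbf{t}\in\mathbb{R}^N,|\mathbf{t}|\le1\}$. *)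

theory Defs
  imports "HOL-Analysis.Analysis"
begin

section \<open>Entire functions of exponential type in several complex variables\<close>

definition of_real_vec :: "real ^ 'n \<Rightarrow> complex ^ 'n" where
  "of_real_vec x = (\<chi> i. complex_of_real (x $ i))"

definition entire :: "(complex ^ 'n \<Rightarrow> complex) \<Rightarrow> bool" where
  "entire F \<longleftrightarrow>
     (\<forall>z. \<exists>D. (F has_derivative D) (at z) \<and> (\<forall>c v. D (c *s v) = c * D v))"

text \<open>
  This norm is in general strictly smaller than the Hermitian norm that the type
  \<open>complex ^ 'n\<close> carries in the library.
\<close>

definition type_norm :: "complex ^ 'n \<Rightarrow> real" where
  "type_norm z =
     Sup {cmod (\<Sum>i\<in>UNIV. z $ i * complex_of_real (t $ i)) | t :: real ^ 'n. norm t \<le> 1}"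

text \<open>
  The logarithm takes the value \<open>-\<infinity>\<close> at the zeros of \<open>F\<close>, so the zero function has
  exponential type \<open>-\<infinity>\<close> and counts as a function of exponential type at most \<open>\<delta>\<close>.
\<close>

definition exponential_type :: "(complex ^ 'n \<Rightarrow> complex) \<Rightarrow> ereal" where
  "exponential_type F =
     Limsup (filtercomap type_norm at_top)
       (\<lambda>z. if F z = 0 then -\<infinity> else ereal (ln (cmod (F z)) / type_norm z))"


section \<open>The extremal problem for the Gaussian\<close>

definition gaussian :: "real \<Rightarrow> real ^ 'n \<Rightarrow> real" where
  "gaussian lam x = exp (- pi * lam * (norm x)\<^sup>2)"

text \<open>
  The case distinction only matters at the origin, where \<open>0 powr 0 = 0\<close>.
\<close>

definition weight :: "real \<Rightarrow> real ^ 'n \<Rightarrow> real" where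
  "weight \<nu> x =
     (if 2 * \<nu> + 2 = real CARD('n) then 1 else norm x powr (2 * \<nu> + 2 - real CARD('n)))"

definition minorants :: "real \<Rightarrow> real \<Rightarrow> (complex ^ 'n \<Rightarrow> complex) set" where
  "minorants \<delta> lam =
     {L. entire L \<and> exponential_type L \<le> ereal \<delta> \<and>
         (\<forall>x. L (of_real_vec x) \<in> \<real> \<and> Re (L (of_real_vec x)) \<le> gaussian lam x)}"

definition majorants :: "real \<Rightarrow> real \<Rightarrow> (complex ^ 'n \<Rightarrow> complex) set" where
  "majorants \<delta> lam =
     {H. entire H \<and> exponential_type H \<le> ereal \<delta> \<and>
         (\<forall>x. H (of_real_vec x) \<in> \<real> \<and> gaussian lam x \<le> Re (H (of_real_vec x)))}"

text \<open>
  All integrands below are nonnegative, so the integrals and infima are taken in \<open>[0, \<infinity>]\<close>.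
  The dimension is passed as a type.
\<close>

definition U_minus :: "'n::finite itself \<Rightarrow> real \<Rightarrow> real \<Rightarrow> real \<Rightarrow> ennreal" where
  "U_minus _ \<nu> \<delta> lam =
     (INF L \<in> (minorants \<delta> lam :: (complex ^ 'n \<Rightarrow> complex) set).
        \<integral>\<^sup>+ x. ennreal ((gaussian lam x - Re (L (of_real_vec x))) * weight \<nu> x) \<partial>lborel)"

definition U_plus :: "'n::finite itself \<Rightarrow> real \<Rightarrow> real \<Rightarrow> real \<Rightarrow> ennreal" where
  "U_plus _ \<nu> \<delta> lam =
     (INF H \<in> (majorants \<delta> lam :: (complex ^ 'n \<Rightarrow> complex) set).
        \<integral>\<^sup>+ x. ennreal ((Re (H (of_real_vec x)) - gaussian lam x) * weight \<nu> x) \<partial>lborel)"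

definition U_minus_measure ::
  "'n::finite itself \<Rightarrow> real \<Rightarrow> real \<Rightarrow> real measure \<Rightarrow> ennreal" where
  "U_minus_measure T \<nu> \<delta> \<mu> = (\<integral>\<^sup>+ lam. U_minus T \<nu> \<delta> lam \<partial>\<mu>)"

definition U_plus_measure ::
  "'n::finite itself \<Rightarrow> real \<Rightarrow> real \<Rightarrow> real measure \<Rightarrow> ennreal" where
  "U_plus_measure T \<nu> \<delta> \<mu> = (\<integral>\<^sup>+ lam. U_plus T \<nu> \<delta> lam \<partial>\<mu>)"


section \<open>The kernel\<close>

definition Q_kernel :: "real measure \<Rightarrow> real ^ 'n \<Rightarrow> real" where
  "Q_kernel \<mu> y =
     (LINT lam|\<mu>. lam powr (- real CARD('n) / 2) * exp (- pi * (norm y)\<^sup>2 / lam))"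

definition off_diagonal_form ::
  "real measure \<Rightarrow> nat \<Rightarrow> (nat \<Rightarrow> complex) \<Rightarrow> (nat \<Rightarrow> real ^ 'n) \<Rightarrow> complex" where
  "off_diagonal_form \<mu> M a y =
     (\<Sum>(j, l) \<in> {(j, l). j \<in> {1..M} \<and> l \<in> {1..M} \<and> j \<noteq> l}.
        a j * cnj (a l) * complex_of_real (Q_kernel \<mu> (y j - y l)))"

end

theory Submission
  imports Defs "HOL-Complex_Analysis.Complex_Analysis" "HOL-Probability.Probability"
begin

text \<open>
  Fix \<open>\<lambda> > 0\<close>, write \<open>g\<close> for the Gaussian, and let \<open>L\<close> be a minorant with \<open>F = g - L\<close>
  integrable. By the Paley--Wiener theorem the Fourier transform of \<open>L\<close> vanishes for
  \<open>|\<xi>| \<ge> \<delta>\<close>, so there the transform \<open>G\<close> of \<open>F\<close> equals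
  \<open>\<lambda>\<^bsup>-N/2\<^esup> exp (- \<pi> |\<xi>|\<^sup>2 / \<lambda>)\<close>. Since \<open>F \<ge> 0\<close>, the quadratic form
  \<open>\<Sum> a\<^sub>j cnj a\<^sub>l G(y\<^sub>j - y\<^sub>l)\<close> is nonnegative, and splitting off its diagonal
  \<open>(\<integral> F) \<Sum> |a\<^sub>j|\<^sup>2\<close> gives the bound for a single Gaussian; integrating over \<open>\<lambda>\<close>
  finishes the proof. Majorants are treated with \<open>F = L - g\<close>.

  In one variable, Paley--Wiener is proved by rotating the Laplace integrals of an entire
  \<open>f\<close> over the two halves of the real line to the ray \<open>-\<i> [0, \<infinity>)\<close>, where they cancel.
\<close>

section \<open>The Paley--Wiener theorem in one variable\<close>

lemma set_integrable_exp_minus: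
  fixes a :: real
  assumes "a > 0"
  shows "set_integrable lborel {0..} (\<lambda>s. exp (- a * s))"
proof -
  have "(\<lambda>s. exp (- a * s)) absolutely_integrable_on {0..}"
    by (intro nonnegative_absolutely_integrable_1 integrable_on_exp_minus_to_infinity assms) auto
  then have "integrable lebesgue (\<lambda>s. indicator {0..} s *\<^sub>R exp (- a * s))"
    by (simp add: set_integrable_def)
  then have "integrable lborel (\<lambda>s. indicator {0..} s *\<^sub>R exp (- a * s))"
    by (subst (asm) integrable_completion)
       (auto intro!: borel_measurable_continuous_on_indicator continuous_intros)
  then show ?thesis by (simp add: set_integrable_def)
qed

section \<open>Laplace transforms on a closed half-plane\<close>

definition laplace :: "(real \<Rightarrow> complex) \<Rightarrow> complex \<Rightarrow> complex" where
  "laplace g w = (LINT s:{0..}|lborel. g s * exp (- w * of_real s))"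

context
  fixes g :: "real \<Rightarrow> complex" and B :: real
  assumes cont: "continuous_on {0..} g"
    and int: "set_integrable lborel {0..} (\<lambda>s. norm (g s) * exp (- B * s))"
begin

lemma laplace_integrand_measurable:
  "(\<lambda>s. indicator {0..} s *\<^sub>R (g s * exp (- w * of_real s))) \<in> borel_measurable lborel"
  by (auto intro!: borel_measurable_continuous_on_indicator continuous_intros cont)

lemma laplace_integrand_bound:
  assumes "Re w \<ge> B"
  shows "norm (indicator {0..} s *\<^sub>R (g s * exp (- w * of_real s)))
    \<le> indicator {0..} s *\<^sub>R (norm (g s) * exp (- B * s))"
  using assms by (auto simp: indicator_def norm_mult mult_right_mono intro!: mult_left_mono)

lemma laplace_integrable:
  assumes "Re w \<ge> B"
  shows "set_integrable lborel {0..} (\<lambda>s. g s * exp (- w * of_real s))"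
  unfolding set_integrable_def
  by (rule Bochner_Integration.integrable_bound[OF int[unfolded set_integrable_def]
        laplace_integrand_measurable])
     (use laplace_integrand_bound[OF assms] in \<open>auto simp: indicator_def\<close>)

text \<open>Absolute integrability at the abscissa \<open>B\<close> itself yields one dominating
  function for the whole closed half-plane. Values on the line \<open>Re w = B\<close> are therefore
  limits from inside; with \<open>B = 0\<close> this reaches the imaginary axis, where the Laplace
  integral becomes half of a Fourier integral.\<close>

lemma laplace_tendsto:
  assumes "\<And>n. Re (v n) \<ge> B" "v \<longlonglongrightarrow> w"
  shows "(\<lambda>n. laplace g (v n)) \<longlonglongrightarrow> laplace g w"
  unfolding laplace_def set_lebesgue_integral_def
proof (rule integral_dominated_convergence[where
      w = "\<lambda>s. indicator {0..} s *\<^sub>R (norm (g s) * exp (- B * s))"])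
  show "integrable lborel (\<lambda>s. indicator {0..} s *\<^sub>R (norm (g s) * exp (- B * s)))"
    using int by (simp add: set_integrable_def)
  show "AE s in lborel. (\<lambda>n. indicator {0..} s *\<^sub>R (g s * exp (- v n * of_real s)))
      \<longlonglongrightarrow> indicator {0..} s *\<^sub>R (g s * exp (- w * of_real s))"
    by (intro AE_I2 tendsto_intros assms)
qed (use laplace_integrand_measurable laplace_integrand_bound[OF assms(1)] in auto)

text \<open>The error of truncation is at most the tail \<open>T n\<close> of the dominating
  integral, which does not depend on \<open>w\<close>. Uniformity serves the holomorphy of the
  limit; pointwise, the limit is used again when the contour is rotated.\<close>

lemma laplace_truncate_uniform:
  "uniform_limit {w. Re w \<ge> B}
     (\<lambda>n w. LINT s:{0..real n}|lborel. g s * exp (- w * of_real s)) (laplace g) sequentially"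
proof -
  let ?h = "\<lambda>s. indicator {0..} s *\<^sub>R (norm (g s) * exp (- B * s))"
  define T where "T = (\<lambda>n. LINT s|lborel. indicator {real n<..} s * ?h s)"
  have hint: "integrable lborel ?h" using int by (simp add: set_integrable_def)
  have "T \<longlonglongrightarrow> (LINT s|(lborel :: real measure). 0)"
    unfolding T_def
  proof (rule integral_dominated_convergence[where w = ?h])
    show "AE s in lborel. (\<lambda>n. indicator {real n<..} s * ?h s) \<longlonglongrightarrow> 0"
    proof (rule AE_I2)
      fix s :: real
      have "eventually (\<lambda>n. real n > s) sequentially"
        using filterlim_real_sequentially by (simp add: filterlim_at_top_dense)
      then have "eventually (\<lambda>n. indicator {real n<..} s * ?h s = 0) sequentially"
        by eventually_elim auto
      then show "(\<lambda>n. indicator {real n<..} s * ?h s) \<longlonglongrightarrow> 0"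
        by (rule tendsto_eventually)
    qed
    show "\<And>n. AE s in lborel. norm (indicator {real n<..} s * ?h s) \<le> ?h s"
      by (auto simp: indicator_def)
  qed (use hint in auto)
  then have T0: "T \<longlonglongrightarrow> 0" by simp
  have bd: "dist (LINT s:{0..real n}|lborel. g s * exp (- w * of_real s)) (laplace g w) \<le> T n"
    if w: "Re w \<ge> B" for n w
  proof -
    let ?k = "\<lambda>s. g s * exp (- w * of_real s)"
    have i1: "set_integrable lborel {0..} ?k" by (rule laplace_integrable[OF w])
    then have i2: "set_integrable lborel {0..real n} ?k"
      by (rule set_integrable_subset) auto
    have "norm ((LINT s:{0..}|lborel. ?k s) - (LINT s:{0..real n}|lborel. ?k s))
        = norm (LINT s|lborel. indicator {0..} s *\<^sub>R ?k s - indicator {0..real n} s *\<^sub>R ?k s)"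
      unfolding set_lebesgue_integral_def using i1 i2
      by (subst Bochner_Integration.integral_diff) (auto simp: set_integrable_def)
    also have "\<dots> \<le> T n"
      unfolding T_def
    proof (rule Bochner_Integration.integral_norm_bound_integral)
      show "integrable lborel (\<lambda>s. indicator {0..} s *\<^sub>R ?k s - indicator {0..real n} s *\<^sub>R ?k s)"
        using i1 i2 by (auto simp: set_integrable_def)
      show "integrable lborel (\<lambda>s. indicator {real n<..} s * ?h s)"
        by (rule Bochner_Integration.integrable_bound[OF hint]) (use hint in \<open>auto simp: indicator_def\<close>)
      show "norm (indicator {0..} s *\<^sub>R ?k s - indicator {0..real n} s *\<^sub>R ?k s)
          \<le> indicator {real n<..} s * ?h s" for s
        using laplace_integrand_bound[OF w, of s] by (auto simp: indicator_def)
    qed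
    finally show ?thesis by (simp add: laplace_def dist_norm norm_minus_commute)
  qed
  show ?thesis
  proof (rule uniform_limitI)
    fix e :: real assume "e > 0"
    with T0 have "eventually (\<lambda>n. T n < e) sequentially"
      by (auto simp: order_tendsto_iff)
    then show "\<forall>\<^sub>F n in sequentially. \<forall>w\<in>{w. Re w \<ge> B}.
        dist (LINT s:{0..real n}|lborel. g s * exp (- w * of_real s)) (laplace g w) < e"
      by eventually_elim (use bd le_less_trans in blast)
  qed
qed

text \<open>Truncated integrals are holomorphic by differentiation under the integral sign, and
  locally uniform limits of holomorphic functions are holomorphic.\<close>

lemma laplace_holomorphic: "laplace g holomorphic_on {w. Re w > B}"
proof (rule holomorphic_uniform_sequence[OF open_halfspace_Re_gt])
  fix n :: nat
  let ?k = "\<lambda>w s. g s * exp (- w * of_real s)"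
  have c: "continuous_on {0..real n} (?k w)" for w
    by (intro continuous_intros continuous_on_subset[OF cont]) auto
  have "(\<lambda>w. integral (cbox 0 (real n)) (?k w)) holomorphic_on {w. Re w > B}"
  proof (rule leibniz_rule_holomorphic)
    fix w :: complex and s :: real
    show "((\<lambda>w. ?k w s) has_field_derivative (g s * exp (- w * of_real s) * - of_real s))
        (at w within {w. Re w > B})"
      by (auto intro!: derivative_eq_intros)
  next
    have "continuous_on ({w. Re w > B} \<times> cbox 0 (real n)) (\<lambda>x. g (snd x))"
      by (rule continuous_on_compose2[OF cont]) (auto intro!: continuous_intros)
    then show "continuous_on ({w. Re w > B} \<times> cbox 0 (real n))
      (\<lambda>(w, s). g s * exp (- w * of_real s) * - of_real s)"
      by (auto simp: case_prod_unfold intro!: continuous_intros)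
  qed (use c in \<open>auto intro!: integrable_continuous_real convex_halfspace_Re_gt\<close>)
  moreover have "(LINT s:{0..real n}|lborel. ?k w s) = integral (cbox 0 (real n)) (?k w)" for w
    using set_borel_integral_eq_integral(2)[OF borel_integrable_atLeastAtMost'[OF c]] by simp
  ultimately show "(\<lambda>w. LINT s:{0..real n}|lborel. ?k w s) holomorphic_on {w. Re w > B}"
    by simp
next
  fix w assume "w \<in> {w. Re w > B}"
  then obtain d where d: "d > 0" "cball w d \<subseteq> {w. Re w > B}"
    using open_halfspace_Re_gt[of B] open_contains_cball by metis
  then have "cball w d \<subseteq> {w. Re w \<ge> B}" by (auto simp: subset_iff less_imp_le)
  with d show "\<exists>d>0. cball w d \<subseteq> {w. Re w > B} \<and> uniform_limit (cball w d)
     (\<lambda>n w. LINT s:{0..real n}|lborel. g s * exp (- w * of_real s)) (laplace g) sequentially"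
    using uniform_limit_on_subset[OF laplace_truncate_uniform] by blast
qed

end

section \<open>Rotation of the ray of integration\<close>

lemma set_integrable_exponential_growth:
  fixes f :: "complex \<Rightarrow> complex" and c :: complex
  assumes bd: "\<And>z. norm (f z) \<le> C * exp (A * norm z)" and B: "B > A"
    and cont: "continuous_on {0..} (\<lambda>s. f (c * of_real s))" and c: "norm c = 1"
  shows "set_integrable lborel {0..} (\<lambda>s. norm (f (c * of_real s)) * exp (- B * s))"
  unfolding set_integrable_def
proof (rule Bochner_Integration.integrable_bound)
  show "integrable lborel (\<lambda>s. C * (indicator {0..} s *\<^sub>R exp (- (B - A) * s)))"
    using set_integrable_exp_minus[of "B - A"] B
    by (intro integrable_mult_right) (simp add: set_integrable_def)
  have "(\<lambda>s. indicator {0..} s *\<^sub>R (norm (f (c * of_real s)) * exp (- B * s)))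
      \<in> borel_measurable borel"
    by (intro borel_measurable_continuous_on_indicator continuous_intros cont) auto
  then show "(\<lambda>s. indicator {0..} s *\<^sub>R (norm (f (c * of_real s)) * exp (- B * s)))
      \<in> borel_measurable lborel"
    by simp
  have "norm (f (c * of_real s)) * exp (- B * s) \<le> C * exp (- (B - A) * s)" if "s \<ge> 0" for s
  proof -
    have "norm (f (c * of_real s)) * exp (- B * s) \<le> (C * exp (A * s)) * exp (- B * s)"
      using bd[of "c * of_real s"] that c by (intro mult_right_mono) (auto simp: norm_mult)
    also have "\<dots> = C * exp (- (B - A) * s)"
      by (simp add: exp_add[symmetric] algebra_simps)
    finally show ?thesis .
  qed
  then show "AE s in lborel. norm (indicator {0..} s *\<^sub>R (norm (f (c * of_real s)) * exp (- B * s)))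
      \<le> norm (C * (indicator {0..} s *\<^sub>R exp (- (B - A) * s)))"
    by (intro AE_I2) (auto simp: indicator_def intro: order_trans[OF _ abs_ge_self])
qed

text \<open>
  The triangle with vertices \<open>0\<close>, \<open>n\<close>, \<open>-\<i> n\<close>: on its hypotenuse \<open>Re (w z)\<close> is at least
  \<open>n min (Re w) (Im w)\<close>, which beats the exponential growth of \<open>f\<close>.
\<close>

lemma laplace_rotate:
  fixes f :: "complex \<Rightarrow> complex"
  assumes hol: "f holomorphic_on UNIV"
    and bd: "\<And>z. norm (f z) \<le> C * exp (A * norm z)" and A: "A \<ge> 0"
    and w: "Re w > A" "Im w > A"
    and intf: "set_integrable lborel {0..} (\<lambda>s. f (of_real s))"
  shows "laplace (\<lambda>s. f (of_real s)) w = - \<i> * laplace (\<lambda>s. f (- \<i> * of_real s)) (- \<i> * w)"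
proof -
  have C: "C \<ge> 0" using bd[of 0] norm_ge_zero[of "f 0"] by (simp del: norm_ge_zero)
  have contf: "continuous_on UNIV f" using hol by (rule holomorphic_on_imp_continuous_on)
  let ?h = "\<lambda>z. f z * exp (- w * z)"
  \<comment> \<open>Cauchy's theorem enters only through a primitive \<open>H\<close>: the integral
    over each edge of the triangle is a difference of values of \<open>H\<close>.\<close>
  have "?h holomorphic_on UNIV" by (intro holomorphic_intros hol)
  then obtain H where H: "\<And>z. (H has_field_derivative ?h z) (at z)"
    using holomorphic_convex_primitive'[of UNIV ?h] by auto
  \<comment> \<open>Needed for \<open>c = 1\<close> and \<open>c = - \<i>\<close>, the two edges
    that meet at \<open>0\<close>.\<close>
  have contour: "(LINT s:{0..real n}|lborel. f (c * of_real s) * exp (- (c * w) * of_real s) * c)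
      = H (c * of_real n) - H 0" for n c
  proof -
    have D: "((\<lambda>s. H (c * of_real s)) has_vector_derivative ?h (c * of_real s) * c) (at s within S)"
      for s S
    proof -
      have "((\<lambda>z. H (c * z)) has_field_derivative ?h (c * of_real s) * c) (at (of_real s))"
        by (rule DERIV_chain'[OF _ H]) (auto intro!: derivative_eq_intros)
      from has_vector_derivative_real_field[OF this] show ?thesis .
    qed
    have c: "continuous_on {0..real n} (\<lambda>s. ?h (c * of_real s) * c)"
      by (intro continuous_intros continuous_on_compose2[OF contf]) auto
    have "((\<lambda>s. ?h (c * of_real s) * c) has_integral H (c * of_real (real n)) - H (c * of_real 0)) {0..real n}"
      by (rule fundamental_theorem_of_calculus[OF _ D]) simp
    from integral_unique[OF this]
    have "integral {0..real n} (\<lambda>s. ?h (c * of_real s) * c) = H (c * of_real n) - H 0"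
      by (simp only: of_real_0 mult_zero_right of_real_of_nat_eq)
    then show ?thesis
      using set_borel_integral_eq_integral(2)[OF borel_integrable_atLeastAtMost'[OF c]]
      by (simp add: mult_ac)
  qed
  then have contour: "(LINT s:{0..real n}|lborel. f (c * of_real s) * exp (- (c * w) * of_real s)) * c
      = H (c * of_real n) - H 0" for n c
    by (simp only: set_integral_mult_left)
  define m where "m = min (Re w) (Im w)"
  have m: "m > A" using w by (simp add: m_def)
  have Hb: "norm (H (1 * of_real n) - H (- \<i> * of_real n)) \<le> 2 * C * (real n * exp (- (m - A) * real n))" for n
  proof -
    let ?S = "closed_segment (1 * of_real n) (- \<i> * of_real n) :: complex set"
    have "norm (H (1 * of_real n) - H (- \<i> * of_real n))
      \<le> (C * exp (- (m - A) * real n)) * norm (1 * of_real n - (- \<i> * of_real n :: complex))"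
    proof (rule field_differentiable_bound[where S = ?S and f' = ?h])
      fix z :: complex assume "z \<in> ?S"
      then obtain u where u: "0 \<le> u" "u \<le> 1"
        and z: "z = (1 - u) *\<^sub>R (1 * of_real n) + u *\<^sub>R (- \<i> * of_real n)"
        unfolding closed_segment_def by auto
      have nz: "norm z \<le> real n"
      proof -
        have "norm z \<le> norm ((1 - u) *\<^sub>R (1 * of_real n) :: complex) + norm (u *\<^sub>R (- \<i> * of_real n) :: complex)"
          unfolding z by (rule norm_triangle_ineq)
        also have "\<dots> = (1 - u) * real n + u * real n" using u by (simp add: norm_mult)
        finally show ?thesis by (simp add: algebra_simps)
      qed
      have "Re (w * z) = real n * ((1 - u) * Re w + u * Im w)"
        by (simp add: z algebra_simps)
      also have "\<dots> \<ge> real n * ((1 - u) * m + u * m)"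
        using u by (intro mult_left_mono add_mono) (auto simp: m_def)
      finally have re: "Re (w * z) \<ge> real n * m" by (simp add: algebra_simps)
      have "norm (?h z) = norm (f z) * exp (- Re (w * z))" by (simp add: norm_mult)
      also have "\<dots> \<le> (C * exp (A * real n)) * exp (- (real n * m))"
      proof (rule mult_mono)
        have "norm (f z) \<le> C * exp (A * norm z)" by (rule bd)
        also have "\<dots> \<le> C * exp (A * real n)" using C A nz by (intro mult_left_mono) (auto intro: mult_left_mono)
        finally show "norm (f z) \<le> C * exp (A * real n)" .
      qed (use re C in auto)
      also have "\<dots> = C * exp (- (m - A) * real n)"
        by (simp add: exp_add[symmetric] algebra_simps)
      finally show "norm (?h z) \<le> C * exp (- (m - A) * real n)" .
    qed (use has_field_derivative_at_within[OF H] in \<open>simp_all only: ends_in_segment convex_closed_segment\<close>)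
    \<comment> \<open>The hypotenuse has length \<open>sqrt 2 * n\<close>; the cruder
      \<open>2 * n\<close> from the triangle inequality suffices.\<close>
    also have "\<dots> \<le> (C * exp (- (m - A) * real n)) * (2 * real n)"
      using norm_triangle_ineq4[of "1 * of_real n" "- \<i> * of_real n :: complex"] C
      by (intro mult_left_mono) (auto simp: norm_mult)
    finally show ?thesis by (simp add: mult_ac)
  qed
  have "(\<lambda>n. real n * exp (- (m - A) * real n)) \<longlonglongrightarrow> 0"
    using m by real_asymp
  then have lim: "(\<lambda>n. 2 * C * (real n * exp (- (m - A) * real n))) \<longlonglongrightarrow> 0"
    by (rule tendsto_mult_right_zero)
  have lim0: "(\<lambda>n. H (1 * of_real n) - H (- \<i> * of_real n)) \<longlonglongrightarrow> 0"
    by (rule Lim_null_comparison[OF _ lim]) (use Hb in auto)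
  have c0: "continuous_on {0..} (\<lambda>s. f (of_real s))" "continuous_on {0..} (\<lambda>s. f (- \<i> * of_real s))"
    by (intro continuous_on_compose2[OF contf] continuous_intros; simp)+
  have i0: "set_integrable lborel {0..} (\<lambda>s. norm (f (of_real s)) * exp (- 0 * s))"
    using set_integrable_norm[OF intf] by simp
  \<comment> \<open>Any value strictly between works: \<open>A < B\<close> makes the integrand on
    the rotated ray integrable, and \<open>B < Im w = Re (- \<i> * w)\<close> puts the new argument
    into the half-plane of convergence.\<close>
  define B where "B = (A + Im w) / 2"
  have B: "A < B" "B < Im w" using w by (auto simp: B_def)
  have i1: "set_integrable lborel {0..} (\<lambda>s. norm (f (- \<i> * of_real s)) * exp (- B * s))"
    using bd B(1) c0(2) by (rule set_integrable_exponential_growth) simp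
  have l1: "(\<lambda>n. H (1 * of_real n) - H 0) \<longlonglongrightarrow> laplace (\<lambda>s. f (of_real s)) w"
    using tendsto_uniform_limitI[OF laplace_truncate_uniform[OF c0(1) i0], of w] w A contour[of _ 1]
    by simp
  have "(\<lambda>n. LINT s:{0..real n}|lborel. f (- \<i> * of_real s) * exp (- (- \<i> * w) * of_real s))
      \<longlonglongrightarrow> laplace (\<lambda>s. f (- \<i> * of_real s)) (- \<i> * w)"
    using tendsto_uniform_limitI[OF laplace_truncate_uniform[OF c0(2) i1], of "- \<i> * w"] B
    by simp
  then have "(\<lambda>n. (LINT s:{0..real n}|lborel. f (- \<i> * of_real s) * exp (- (- \<i> * w) * of_real s)) * (- \<i>))
      \<longlonglongrightarrow> laplace (\<lambda>s. f (- \<i> * of_real s)) (- \<i> * w) * (- \<i>)"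
    by (intro tendsto_intros)
  then have l2: "(\<lambda>n. H (- \<i> * of_real n) - H 0) \<longlonglongrightarrow> laplace (\<lambda>s. f (- \<i> * of_real s)) (- \<i> * w) * (- \<i>)"
    by (simp only: contour[of _ "- \<i>"])
  have "(\<lambda>n. H (1 * of_real n) - H (- \<i> * of_real n))
      \<longlonglongrightarrow> laplace (\<lambda>s. f (of_real s)) w - laplace (\<lambda>s. f (- \<i> * of_real s)) (- \<i> * w) * (- \<i>)"
    using tendsto_diff[OF l1 l2] by simp
  from LIMSEQ_unique[OF this lim0] show ?thesis
    by (simp add: mult.commute eq_neg_iff_add_eq_0)
qed

lemma cnj_laplace: "cnj (laplace g w) = laplace (\<lambda>s. cnj (g s)) (cnj w)"
proof -
  have "cnj (laplace g w) = (LINT s|lborel. cnj (indicator {0..} s *\<^sub>R (g s * exp (- w * of_real s))))"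
    unfolding laplace_def set_lebesgue_integral_def by (rule Bochner_Integration.integral_cnj[symmetric])
  also have "\<dots> = laplace (\<lambda>s. cnj (g s)) (cnj w)"
    unfolding laplace_def set_lebesgue_integral_def
    by (rule Bochner_Integration.integral_cong) (auto simp: exp_cnj)
  finally show ?thesis .
qed

text \<open>
  The identity above is continued analytically to \<open>Re w > 0\<close>, \<open>Im w > A\<close> and then extended to
  the boundary by dominated convergence.
\<close>

lemma laplace_rotate_boundary:
  fixes f :: "complex \<Rightarrow> complex"
  assumes hol: "f holomorphic_on UNIV"
    and bd: "\<And>z. norm (f z) \<le> C * exp (A * norm z)" and A: "A \<ge> 0"
    and intf: "set_integrable lborel {0..} (\<lambda>s. f (of_real s))"
    and y: "y > A"
  shows "laplace (\<lambda>s. f (of_real s)) (\<i> * of_real y)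
    = - \<i> * laplace (\<lambda>s. f (- \<i> * of_real s)) (of_real y)"
proof -
  let ?L0 = "laplace (\<lambda>s. f (of_real s))" and ?L1 = "laplace (\<lambda>s. f (- \<i> * of_real s))"
  have contf: "continuous_on UNIV f" using hol by (rule holomorphic_on_imp_continuous_on)
  have c0: "continuous_on {0..} (\<lambda>s. f (of_real s))" "continuous_on {0..} (\<lambda>s. f (- \<i> * of_real s))"
    by (intro continuous_on_compose2[OF contf] continuous_intros; simp)+
  have i0: "set_integrable lborel {0..} (\<lambda>s. norm (f (of_real s)) * exp (- 0 * s))"
    using set_integrable_norm[OF intf] by simp
  \<comment> \<open>On the rotated ray the transform is controlled only from an abscissa strictly
    above \<open>A\<close> on. The continuation is therefore carried out on \<open>Im w > B\<close>,
    which still contains the points that approach \<open>\<i> * y\<close>.\<close>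
  define B where "B = (A + y) / 2"
  have B: "A < B" "B < y" using y by (auto simp: B_def)
  have i1: "set_integrable lborel {0..} (\<lambda>s. norm (f (- \<i> * of_real s)) * exp (- B * s))"
    using bd B(1) c0(2) by (rule set_integrable_exponential_growth) simp
  have eq: "?L0 w = - \<i> * ?L1 (- \<i> * w)" if w: "Re w > 0" "Im w > B" for w
  proof (rule analytic_continuation_open[where f = ?L0 and g = "\<lambda>w. - \<i> * ?L1 (- \<i> * w)"
        and s = "{w. Re w > A} \<inter> {w. Im w > B}" and s' = "{w. Re w > 0} \<inter> {w. Im w > B}"])
    show "open ({w. Re w > A} \<inter> {w. Im w > B})" "open ({w. Re w > 0} \<inter> {w. Im w > B})"
      by (intro open_Int open_halfspace_Re_gt open_halfspace_Im_gt)+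
    have "Complex (A + 1) (B + 1) \<in> {w. Re w > A} \<inter> {w. Im w > B}" by simp
    then show "{w. Re w > A} \<inter> {w. Im w > B} \<noteq> {}" by blast
    show "connected ({w. Re w > 0} \<inter> {w. Im w > B})"
      by (intro convex_connected convex_Int convex_halfspace_Re_gt convex_halfspace_Im_gt)
    show "?L0 holomorphic_on {w. Re w > 0} \<inter> {w. Im w > B}"
      using laplace_holomorphic[OF c0(1) i0] by (rule holomorphic_on_subset) auto
    have "?L1 \<circ> (\<lambda>w. - \<i> * w) holomorphic_on {w. Re w > 0} \<inter> {w. Im w > B}"
      by (rule holomorphic_on_compose_gen[OF _ laplace_holomorphic[OF c0(2) i1]])
         (auto intro!: holomorphic_intros)
    then show "(\<lambda>w. - \<i> * ?L1 (- \<i> * w)) holomorphic_on {w. Re w > 0} \<inter> {w. Im w > B}"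
      by (intro holomorphic_on_mult holomorphic_on_const) (simp add: o_def)
    show "?L0 z = - \<i> * ?L1 (- \<i> * z)" if "z \<in> {w. Re w > A} \<inter> {w. Im w > B}" for z
      using that B by (intro laplace_rotate[OF hol bd A _ _ intf]) auto
  qed (use A w in auto)
  \<comment> \<open>The points keep the imaginary part \<open>y > B\<close> and approach the
    imaginary axis from the right, so they stay in the quadrant where the identity is known.\<close>
  define v where "v = (\<lambda>n. \<i> * of_real y + of_real (inverse (real (Suc n))) :: complex)"
  have v: "v \<longlonglongrightarrow> \<i> * of_real y + of_real 0"
    unfolding v_def by (intro tendsto_intros LIMSEQ_inverse_real_of_nat)
  have vre: "Re (v n) > 0" "Im (v n) = y" for n by (auto simp: v_def simp del: of_nat_Suc)
  have l0: "(\<lambda>n. ?L0 (v n)) \<longlonglongrightarrow> ?L0 (\<i> * of_real y)"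
    using v vre by (intro laplace_tendsto[OF c0(1) i0]) (auto intro: less_imp_le)
  have v1: "(\<lambda>n. - \<i> * v n) \<longlonglongrightarrow> - \<i> * (\<i> * of_real y + of_real 0)"
    by (intro tendsto_intros v)
  have l1: "(\<lambda>n. ?L1 (- \<i> * v n)) \<longlonglongrightarrow> ?L1 (of_real y)"
    using v1 vre B by (intro laplace_tendsto[OF c0(2) i1]) (auto simp: algebra_simps)
  have "(\<lambda>n. - \<i> * ?L1 (- \<i> * v n)) \<longlonglongrightarrow> - \<i> * ?L1 (of_real y)"
    by (intro tendsto_intros l1)
  then show ?thesis
    using l0 vre B by (subst (asm) eq[symmetric]) (auto intro: LIMSEQ_unique)
qed

text \<open>Each half of the Fourier integral is a Laplace transform at a point of the imaginary
  axis. After rotation both become the same integral over the ray from \<open>0\<close> through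
  \<open>- \<i>\<close>, with opposite factors.\<close>

lemma paley_wiener_line:
  fixes f :: "complex \<Rightarrow> complex"
  assumes hol: "f holomorphic_on UNIV"
    and bd: "\<And>z. norm (f z) \<le> C * exp (A * norm z)" and A: "A \<ge> 0"
    and intf: "integrable lborel (\<lambda>t. f (of_real t))"
    and y: "y > A"
  shows "(LINT t|lborel. f (of_real t) * exp (- (\<i> * of_real y) * of_real t)) = 0"
proof -
  \<comment> \<open>The map sending \<open>z\<close> to \<open>- cnj z\<close> fixes the imaginary
    axis pointwise and swaps the two real half-lines. Up to conjugation, the integral over
    \<open>t < 0\<close> is thus the transform of \<open>f'\<close> at the same point
    \<open>\<i> * y\<close>, and the same rotation applies.\<close>
  define f' where "f' = (\<lambda>z. cnj (f (- cnj z)))"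
  have "f \<circ> uminus holomorphic_on UNIV"
    by (intro holomorphic_on_compose_gen[OF _ hol] holomorphic_intros) auto
  then have "cnj \<circ> (f \<circ> uminus) \<circ> cnj holomorphic_on UNIV"
    by (intro holomorphic_on_compose_cnj_cnj) (auto simp: holomorphic_on_subset)
  then have hol': "f' holomorphic_on UNIV" by (simp add: f'_def o_def)
  have bd': "norm (f' z) \<le> C * exp (A * norm z)" for z
    using bd[of "- cnj z"] by (simp add: f'_def)
  have intm: "integrable lborel (\<lambda>t. f (- of_real t))"
    using lborel_integrable_real_affine[OF intf, of "-1" 0] by simp
  have set_int: "set_integrable lborel {0..} (\<lambda>s. f (of_real s))"
    "set_integrable lborel {0..} (\<lambda>s. f' (of_real s))"
    unfolding set_integrable_def f'_def using intf intm
    by (auto intro!: integrable_mult_indicator)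
  let ?k = "\<lambda>t. f (of_real t) * exp (- (\<i> * of_real y) * of_real t)"
  have intk: "integrable lborel ?k"
  proof (rule Bochner_Integration.integrable_bound[OF intf])
    have "continuous_on UNIV (\<lambda>t::real. f (of_real t))"
      by (rule continuous_on_compose2[OF holomorphic_on_imp_continuous_on[OF hol]])
         (auto intro!: continuous_intros)
    then show "?k \<in> borel_measurable lborel"
      by (auto intro!: borel_measurable_continuous_onI continuous_intros)
  qed (auto simp: norm_mult)
  have "(LINT t|lborel. ?k t) = (LINT t:{0..}|lborel. ?k t) + (LINT t:{..<0}|lborel. ?k t)"
  proof -
    have u: "{0..} \<union> {..<0} = (UNIV :: real set)" "{0..} \<inter> {..<0} = ({} :: real set)" by auto
    have "set_integrable lborel S ?k" if "S \<in> sets borel" for S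
      using that intk by (auto simp: set_integrable_def intro!: integrable_mult_indicator)
    from set_integral_Un[OF u(2) this this] show ?thesis
      unfolding u by (simp add: set_lebesgue_integral_def)
  qed
  also have "(LINT t:{..<0}|lborel. ?k t) = (LINT t:{0..}|lborel. ?k (- t))"
  proof -
    have "(LINT t:{..<0}|lborel. ?k t) = (LINT t|lborel. indicator {..<0} (- t) *\<^sub>R ?k (- t))"
      unfolding set_lebesgue_integral_def
      using lborel_integral_real_affine[of "-1" "\<lambda>t. indicator {..<0} t *\<^sub>R ?k t" 0] by simp
    also have "\<dots> = (LINT t|lborel. indicator {0..} t *\<^sub>R ?k (- t))"
      using AE_lborel_singleton[of "0::real"] intk lborel_integrable_real_affine[OF intk, of "-1" 0]
      by (intro integral_cong_AE) (auto simp: indicator_def)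
    finally show ?thesis by (simp add: set_lebesgue_integral_def)
  qed
  also have "(LINT t:{0..}|lborel. ?k t) = laplace (\<lambda>s. f (of_real s)) (\<i> * of_real y)"
    by (simp add: laplace_def)
  also have "\<dots> = - \<i> * laplace (\<lambda>s. f (- \<i> * of_real s)) (of_real y)"
    by (rule laplace_rotate_boundary[OF hol bd A set_int(1) y])
  also have "(LINT t:{0..}|lborel. ?k (- t)) = laplace (\<lambda>s. cnj (f' (of_real s))) (cnj (\<i> * of_real y))"
    by (simp add: laplace_def f'_def)
  also have "\<dots> = cnj (laplace (\<lambda>s. f' (of_real s)) (\<i> * of_real y))"
    by (rule cnj_laplace[symmetric])
  also have "laplace (\<lambda>s. f' (of_real s)) (\<i> * of_real y) = - \<i> * laplace (\<lambda>s. f' (- \<i> * of_real s)) (of_real y)"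
    by (rule laplace_rotate_boundary[OF hol' bd' A set_int(2) y])
  \<comment> \<open>On the rotated ray \<open>f'\<close> is the conjugate of \<open>f\<close>, so
    the outer conjugation restores \<open>f\<close> and turns the factor \<open>- \<i>\<close> into
    \<open>\<i>\<close>; the two halves cancel.\<close>
  also have "cnj \<dots> = \<i> * laplace (\<lambda>s. f (- \<i> * of_real s)) (of_real y)"
    by (simp add: cnj_laplace f'_def)
  finally show ?thesis by simp
qed

section \<open>The Paley--Wiener theorem in several variables\<close>

lemma inner_of_real_vec:
  "(\<Sum>i\<in>UNIV. of_real_vec x $ i * complex_of_real (t $ i)) = of_real (x \<bullet> t)"
  by (simp add: of_real_vec_def inner_vec_def)

text \<open>On a complex line with real base point and real unit direction, \<open>type_norm\<close>
  agrees with \<open>norm w\<close> up to the bounded error \<open>norm x\<close>. The upper bound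
  is Cauchy-Schwarz, the lower one tests the supremum with \<open>t = u\<close>. Restriction to such
  a line therefore does not increase the exponential type.\<close>

lemma type_norm_line:
  fixes x u :: "real ^ 'n"
  assumes u: "norm u = 1"
  shows "type_norm (of_real_vec x + w *s of_real_vec u) \<le> norm x + norm w" (is ?upper)
    and "norm w - norm x \<le> type_norm (of_real_vec x + w *s of_real_vec u)" (is ?lower)
proof -
  let ?z = "of_real_vec x + w *s of_real_vec u"
  let ?v = "\<lambda>t. cmod (\<Sum>i\<in>UNIV. ?z $ i * complex_of_real (t $ i))"
  have eq: "?v t = cmod (of_real (x \<bullet> t) + w * of_real (u \<bullet> t))" for t
    unfolding inner_of_real_vec[symmetric]
    by (simp add: sum_distrib_left sum.distrib[symmetric] algebra_simps)
  have le: "?v t \<le> norm x + norm w" if "norm t \<le> 1" for t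
  proof -
    have ip: "\<bar>a \<bullet> t\<bar> \<le> norm a" for a
      using Cauchy_Schwarz_ineq2[of a t] that mult_left_mono[of "norm t" 1 "norm a"] by simp
    have "?v t \<le> \<bar>x \<bullet> t\<bar> + norm w * \<bar>u \<bullet> t\<bar>"
      unfolding eq using norm_triangle_ineq[of "of_real (x \<bullet> t)" "w * of_real (u \<bullet> t)"]
      by (simp add: norm_mult)
    also have "\<dots> \<le> norm x + norm w * 1"
      using ip[of x] ip[of u] u by (intro add_mono mult_left_mono) auto
    finally show ?thesis by simp
  qed
  have ne: "{?v t | t. norm t \<le> 1} \<noteq> {}" by (auto intro: exI[of _ 0])
  show ?upper
    unfolding type_norm_def using le by (intro cSup_least[OF ne]) auto
  have "norm w - norm x \<le> norm w - norm (of_real (x \<bullet> u) :: complex)"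
    using Cauchy_Schwarz_ineq2[of x u] u by simp
  also have "\<dots> \<le> ?v u"
    unfolding eq using u norm_diff_ineq[of w "of_real (x \<bullet> u)"]
    by (simp add: dot_square_norm add.commute)
  also have "\<dots> \<le> type_norm ?z"
    unfolding type_norm_def using u le by (intro cSup_upper bdd_aboveI[of _ "norm x + norm w"]) auto
  finally show ?lower .
qed

lemma entire_imp_continuous: "entire L \<Longrightarrow> continuous_on S L"
  unfolding entire_def
  by (intro continuous_at_imp_continuous_on ballI) (blast intro: has_derivative_continuous)

lemma bounded_linear_scale_vec: "bounded_linear (\<lambda>w :: complex. w *s (b :: complex ^ 'n))"
  by (intro linear_conv_bounded_linear[THEN iffD1] linearI)
     (auto simp: vec_eq_iff algebra_simps)

text \<open>Complex homogeneity of the Frechet derivative \<open>D\<close> reduces its action on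
  \<open>h *s b\<close> to multiplication of \<open>h\<close> by \<open>D b\<close>, which is a
  complex derivative.\<close>

lemma entire_holomorphic_line:
  assumes "entire L"
  shows "(\<lambda>w. L (a + w *s b)) holomorphic_on UNIV"
proof (rule holomorphic_onI)
  fix w :: complex
  obtain D where D: "(L has_derivative D) (at (a + w *s b))" "\<And>c v. D (c *s v) = c * D v"
    using assms unfolding entire_def by blast
  have "((\<lambda>w. a + w *s b) has_derivative (\<lambda>h. h *s b)) (at w)"
    using bounded_linear_imp_has_derivative[OF bounded_linear_scale_vec]
    by (auto intro!: derivative_eq_intros)
  from has_derivative_compose[OF this D(1)]
  have "((\<lambda>w. L (a + w *s b)) has_derivative (\<lambda>h. h * D b)) (at w)"
    by (simp add: D(2))
  then have "((\<lambda>w. L (a + w *s b)) has_field_derivative D b) (at w)"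
    unfolding has_field_derivative_def mult_commute_abs .
  then show "(\<lambda>w. L (a + w *s b)) field_differentiable at w within UNIV"
    using field_differentiable_def by blast
qed

text \<open>The limsup controls \<open>L\<close> only where \<open>type_norm\<close> is large, and
  there the strict inequality \<open>\<tau> < A\<close> absorbs its error. The rest of the line lies
  in a compact disc, where continuity gives a bound.\<close>

lemma exponential_type_line:
  fixes x u :: "real ^ 'n" and L :: "complex ^ 'n \<Rightarrow> complex"
  assumes L: "entire L" "exponential_type L \<le> ereal \<tau>" and A: "\<tau> < A" "0 \<le> A"
    and u: "norm u = 1"
  shows "\<exists>C. \<forall>w. norm (L (of_real_vec x + w *s of_real_vec u)) \<le> C * exp (A * norm w)"
proof -
  let ?f = "\<lambda>w. L (of_real_vec x + w *s of_real_vec u)"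
  have "exponential_type L < ereal A"
    using L(2) A(1) by (meson le_less_trans less_ereal.simps(1))
  then have "eventually (\<lambda>z. (if L z = 0 then -\<infinity> else ereal (ln (cmod (L z)) / type_norm z)) < ereal A)
      (filtercomap type_norm at_top)"
    unfolding exponential_type_def by (rule Limsup_lessD)
  then obtain N where N: "\<And>z. type_norm z \<ge> N \<Longrightarrow>
      (if L z = 0 then -\<infinity> else ereal (ln (cmod (L z)) / type_norm z)) < ereal A"
    unfolding eventually_filtercomap_at_top_linorder by blast
  \<comment> \<open>The \<open>1\<close> in \<open>max N 1\<close> makes \<open>type_norm z\<close>
    positive, so that the quotient can be cleared.\<close>
  have big: "norm (L z) \<le> exp (A * type_norm z)" if "type_norm z \<ge> max N 1" for z
  proof (cases "L z = 0")
    case False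
    then have "ln (cmod (L z)) / type_norm z < A" using N[of z] that by auto
    then have "ln (cmod (L z)) < A * type_norm z" using that by (simp add: field_simps)
    then have "exp (ln (cmod (L z))) \<le> exp (A * type_norm z)" by simp
    then show ?thesis using False by simp
  qed auto
  define R where "R = max N 1 + norm x"
  have contf: "continuous_on (cball 0 R) ?f"
    using entire_holomorphic_line[OF L(1)] holomorphic_on_imp_continuous_on continuous_on_subset by blast
  obtain K where "\<forall>y\<in>?f ` cball 0 R. norm y \<le> K"
    using compact_imp_bounded[OF compact_continuous_image[OF contf compact_cball]]
    unfolding bounded_iff by blast
  then have K: "norm (?f w) \<le> K" if "norm w \<le> R" for w
    using that by simp
  show ?thesis
  proof (intro exI allI)
    fix w
    \<comment> \<open>The summand \<open>\<bar>K\<bar>\<close> serves the disc of radius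
      \<open>R\<close>; outside it \<open>exp (A * norm x)\<close> pays for the excess of
      \<open>type_norm\<close> over \<open>norm w\<close>.\<close>
    show "norm (?f w) \<le> (\<bar>K\<bar> + exp (A * norm x)) * exp (A * norm w)"
    proof (cases "norm w \<le> R")
      case True
      have "norm (?f w) \<le> \<bar>K\<bar> * 1" using K[OF True] by simp
      also have "\<dots> \<le> (\<bar>K\<bar> + exp (A * norm x)) * exp (A * norm w)"
        using A by (intro mult_mono) auto
      finally show ?thesis .
    next
      case False
      then have "max N 1 + norm x < norm w" unfolding R_def by (simp only: not_le)
      then have "max N 1 \<le> type_norm (of_real_vec x + w *s of_real_vec u)"
        using type_norm_line(2)[OF u, of w x] by linarith
      from big[OF this]
      have "norm (?f w) \<le> exp (A * type_norm (of_real_vec x + w *s of_real_vec u))" .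
      also have "\<dots> \<le> exp (A * (norm x + norm w))"
        using type_norm_line(1)[OF u, of x w] A by (simp add: mult_left_mono)
      also have "\<dots> \<le> (\<bar>K\<bar> + exp (A * norm x)) * exp (A * norm w)"
        by (simp add: distrib_left exp_add algebra_simps)
      finally show ?thesis .
    qed
  qed
qed

lemma continuous_of_real_vec: "continuous_on S of_real_vec"
  unfolding of_real_vec_def[abs_def]
  by (rule continuous_on_vec_lambda, rule continuous_on_of_real, rule continuous_on_component,
      rule continuous_on_id)

lemma of_real_vec_add: "of_real_vec (x + y) = of_real_vec x + of_real_vec y"
  and of_real_vec_scaleR: "of_real_vec (t *\<^sub>R x) = of_real t *s of_real_vec x"
  by (simp_all add: of_real_vec_def vec_eq_iff)

section \<open>Integration along parallel lines\<close>

lemma nn_integral_lborel_translate: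
  fixes c :: "'a::euclidean_space"
  assumes [measurable]: "f \<in> borel_measurable borel"
  shows "(\<integral>\<^sup>+x. f (c + x) \<partial>lborel) = (\<integral>\<^sup>+x. f x \<partial>lborel)"
proof -
  have "(\<integral>\<^sup>+x. f x \<partial>lborel) = (\<integral>\<^sup>+x. f x \<partial>distr lborel borel ((+) c))"
    by (simp only: lborel_distr_plus)
  also have "\<dots> = (\<integral>\<^sup>+x. f (c + x) \<partial>lborel)"
    by (rule nn_integral_distr) auto
  finally show ?thesis by simp
qed

lemma integral_lborel_translate:
  fixes c :: "'a::euclidean_space" and f :: "'a \<Rightarrow> 'b::{banach,second_countable_topology}"
  assumes [measurable]: "f \<in> borel_measurable borel"
  shows "(LINT x|lborel. f (c + x)) = (LINT x|lborel. f x)"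
proof -
  have "(LINT x|lborel. f x) = (LINT x|distr lborel borel ((+) c). f x)"
    by (simp only: lborel_distr_plus)
  also have "\<dots> = (LINT x|lborel. f (c + x))"
    by (rule integral_distr) auto
  finally show ?thesis by simp
qed

text \<open>
  Fubini along the lines in direction \<open>u\<close>, with the slab \<open>0 \<le> x \<bullet> u \<le> 1\<close> as a set of base
  points. It makes an orthogonal change of coordinates unnecessary.
\<close>

lemma
  fixes G :: "'a::euclidean_space \<Rightarrow> complex" and u :: 'a
  assumes u: "norm u = 1" and G: "integrable lborel G"
  shows integrable_along_lines:
      "AE x in lborel. x \<bullet> u \<in> {0..1} \<longrightarrow> integrable lborel (\<lambda>t. G (t *\<^sub>R u + x))"
    and integral_along_lines:
      "(LINT x|lborel. G x) = (LINT x|lborel. indicator {0..1} (x \<bullet> u) *\<^sub>R (LINT t|lborel. G (t *\<^sub>R u + x)))"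
proof -
  have [measurable]: "G \<in> borel_measurable borel" using G by auto
  have uu: "u \<bullet> u = 1" using u by (simp add: dot_square_norm)
  \<comment> \<open>\<open>H\<close> pairs base points of the slab with parameters on their lines,
    and \<open>K\<close> is the same integrand in terms of the end point. For fixed \<open>x\<close>
    the parameter \<open>t\<close> in \<open>K\<close> runs over an interval of length
    \<open>1\<close>, so integrating it out gives back \<open>G x\<close>. Tonelli for the norms
    comes first, to justify Fubini.\<close>
  define H where "H = (\<lambda>(x::'a) (t::real). indicator {0..1} (x \<bullet> u) *\<^sub>R G (t *\<^sub>R u + x))"
  define K where "K = (\<lambda>(x::'a) (t::real). indicator {0..1} (x \<bullet> u - t) *\<^sub>R G x)"
  have Hm [measurable]: "case_prod H \<in> borel_measurable (lborel \<Otimes>\<^sub>M lborel)"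
    and Km [measurable]: "case_prod K \<in> borel_measurable (lborel \<Otimes>\<^sub>M lborel)"
    unfolding H_def K_def case_prod_unfold by measurable
  have HK: "H x t = K (t *\<^sub>R u + x) t" for x t
    by (simp add: H_def K_def inner_add_left uu)
  have ind: "indicator {0..1} (a - t) = indicator {a - 1..a} t" for a t :: real
    by (auto simp: indicator_def)
  have nK: "(\<integral>\<^sup>+x. \<integral>\<^sup>+t. norm (K x t) \<partial>lborel \<partial>lborel) = (\<integral>\<^sup>+x. norm (G x) \<partial>lborel)"
  proof (intro nn_integral_cong)
    fix x
    have "(\<integral>\<^sup>+t. norm (K x t) \<partial>lborel) = (\<integral>\<^sup>+t. ennreal (norm (G x)) * indicator {x \<bullet> u - 1..x \<bullet> u} t \<partial>lborel)"
      by (intro nn_integral_cong) (auto simp: K_def ind indicator_def)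
    also have "\<dots> = norm (G x)" by (simp add: nn_integral_cmult_indicator)
    finally show "(\<integral>\<^sup>+t. norm (K x t) \<partial>lborel) = norm (G x)" .
  qed
  have nH: "(\<integral>\<^sup>+x. \<integral>\<^sup>+t. norm (H x t) \<partial>lborel \<partial>lborel) = (\<integral>\<^sup>+x. \<integral>\<^sup>+t. norm (K x t) \<partial>lborel \<partial>lborel)"
  proof -
    have "(\<integral>\<^sup>+x. \<integral>\<^sup>+t. norm (H x t) \<partial>lborel \<partial>lborel) = (\<integral>\<^sup>+t. \<integral>\<^sup>+x. norm (H x t) \<partial>lborel \<partial>lborel)"
      by (rule lborel_pair.Fubini'[symmetric]) simp
    also have "\<dots> = (\<integral>\<^sup>+t. \<integral>\<^sup>+x. norm (K x t) \<partial>lborel \<partial>lborel)"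
      unfolding HK by (intro nn_integral_cong nn_integral_lborel_translate) (simp add: K_def)
    also have "\<dots> = (\<integral>\<^sup>+x. \<integral>\<^sup>+t. norm (K x t) \<partial>lborel \<partial>lborel)"
      by (rule lborel_pair.Fubini') simp
    finally show ?thesis .
  qed
  have fin: "(\<integral>\<^sup>+x. norm (G x) \<partial>lborel) < \<infinity>" using G by (simp add: integrable_iff_bounded)
  have Kint: "integrable (lborel \<Otimes>\<^sub>M lborel) (\<lambda>(x, t). K x t)"
    unfolding integrable_iff_bounded using fin nK Km
    by (auto simp: lborel.nn_integral_fst[symmetric] split_beta)
  have Hint: "integrable (lborel \<Otimes>\<^sub>M lborel) (\<lambda>(x, t). H x t)"
    unfolding integrable_iff_bounded using fin nK nH Hm
    by (auto simp: lborel.nn_integral_fst[symmetric] split_beta)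
  show "AE x in lborel. x \<bullet> u \<in> {0..1} \<longrightarrow> integrable lborel (\<lambda>t. G (t *\<^sub>R u + x))"
    using lborel_pair.AE_integrable_fst[OF Hint] by eventually_elim (auto simp: H_def indicator_def split: if_splits)
  have "(LINT x|lborel. G x) = (LINT x|lborel. LINT t|lborel. K x t)"
    by (intro Bochner_Integration.integral_cong) (simp_all add: K_def ind)
  also have "\<dots> = (LINT t|lborel. LINT x|lborel. K x t)"
    by (rule lborel_pair.Fubini_integral[OF Kint, symmetric])
  also have "\<dots> = (LINT t|lborel. LINT x|lborel. H x t)"
    unfolding HK by (intro Bochner_Integration.integral_cong integral_lborel_translate[symmetric])
      (simp_all add: K_def)
  also have "\<dots> = (LINT x|lborel. LINT t|lborel. H x t)"
    by (rule lborel_pair.Fubini_integral[OF Hint])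
  also have "\<dots> = (LINT x|lborel. indicator {0..1} (x \<bullet> u) *\<^sub>R (LINT t|lborel. G (t *\<^sub>R u + x)))"
    by (simp add: H_def)
  finally show "(LINT x|lborel. G x) = (LINT x|lborel. indicator {0..1} (x \<bullet> u) *\<^sub>R (LINT t|lborel. G (t *\<^sub>R u + x)))" .
qed

section \<open>The Fourier transform and its support\<close>

definition fourier :: "('a::euclidean_space \<Rightarrow> complex) \<Rightarrow> 'a \<Rightarrow> complex" where
  "fourier F \<xi> = (LINT x|lborel. F x * cis (- (2 * pi * (x \<bullet> \<xi>))))"

lemma measurable_cis_inner [measurable]:
  "(\<lambda>x. cis (- (c * (x \<bullet> \<xi>)))) \<in> borel_measurable borel"
  by (intro borel_measurable_continuous_onI continuous_intros)

lemma fourier_integrable: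
  assumes "integrable lborel F"
  shows "integrable lborel (\<lambda>x. F x * cis (- (2 * pi * (x \<bullet> \<xi>))))"
proof (rule Bochner_Integration.integrable_bound[OF assms])
  have [measurable]: "F \<in> borel_measurable borel"
    using borel_measurable_integrable[OF assms] by simp
  show "(\<lambda>x. F x * cis (- (2 * pi * (x \<bullet> \<xi>)))) \<in> borel_measurable lborel"
    by measurable
  show "AE x in lborel. norm (F x * cis (- (2 * pi * (x \<bullet> \<xi>)))) \<le> norm (F x)"
    by (simp add: norm_mult)
qed

text \<open>Dominated convergence with \<open>norm (F x)\<close>. This continuity extends the
  vanishing of a transform from \<open>\<delta> < norm \<xi>\<close> to the sphere
  \<open>norm \<xi> = \<delta>\<close>, which the non-strict separation of the points
  requires.\<close>

lemma fourier_tendsto: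
  assumes F: "integrable lborel F" and v: "v \<longlonglongrightarrow> \<xi>"
  shows "(\<lambda>n. fourier F (v n)) \<longlonglongrightarrow> fourier F \<xi>"
  unfolding fourier_def
proof (rule integral_dominated_convergence[where w = "\<lambda>x. norm (F x)"])
  show "AE x in lborel. (\<lambda>n. F x * cis (- (2 * pi * (x \<bullet> v n)))) \<longlonglongrightarrow> F x * cis (- (2 * pi * (x \<bullet> \<xi>)))"
    unfolding cis_conv_exp by (intro AE_I2 tendsto_intros v)
  show "AE x in lborel. norm (F x * cis (- (2 * pi * (x \<bullet> v n)))) \<le> norm (F x)" for n
    by (simp add: norm_mult)
qed (intro borel_measurable_integrable fourier_integrable F integrable_norm)+

text \<open>Integrating first along lines in the direction of \<open>\<xi>\<close> leaves
  one-variable Fourier integrals at frequency \<open>2 * pi * norm \<xi>\<close>. If this exceeds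
  the type, almost all of the inner integrals over the slab vanish; the case of equality follows by
  continuity.\<close>

lemma paley_wiener:
  fixes L :: "complex ^ 'n \<Rightarrow> complex" and \<xi> :: "real ^ 'n"
  assumes L: "entire L" "exponential_type L \<le> ereal (2 * pi * \<delta>)"
    and int: "integrable lborel (\<lambda>x. L (of_real_vec x))"
    and \<delta>: "0 < \<delta>" "\<delta> \<le> norm \<xi>"
  shows "fourier (\<lambda>x. L (of_real_vec x)) \<xi> = 0"
proof -
  have strict: "fourier (\<lambda>x. L (of_real_vec x)) \<xi> = 0" if \<xi>: "\<delta> < norm \<xi>" for \<xi> :: "real ^ 'n"
  proof -
    define u where "u = \<xi> /\<^sub>R norm \<xi>"
    have u: "norm u = 1" "u \<bullet> \<xi> = norm \<xi>"
    proof -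
      have "norm \<xi> \<noteq> 0" using \<xi> \<delta> by linarith
      then show "norm u = 1" "u \<bullet> \<xi> = norm \<xi>"
        by (simp_all add: u_def dot_square_norm power2_eq_square)
    qed
    let ?y = "2 * pi * norm \<xi>"
    \<comment> \<open>The left inequality leaves room for the limsup in the exponential type, the
      right one is the gap required in one variable.\<close>
    obtain A where A: "2 * pi * \<delta> < A" "A < ?y"
      using \<xi> dense[of "2 * pi * \<delta>" ?y] by auto
    have A0: "0 \<le> A" using A(1) \<delta> by (smt (verit) pi_gt_zero mult_pos_pos)
    \<comment> \<open>Along a line in direction \<open>u\<close> the character splits into a factor
      of modulus one that depends on the base point and the one-variable exponential at frequency
      \<open>?y\<close>.\<close>
    let ?G = "\<lambda>x. L (of_real_vec x) * cis (- (2 * pi * (x \<bullet> \<xi>)))"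
    have line: "?G (t *\<^sub>R u + x) = cis (- (2 * pi * (x \<bullet> \<xi>))) *
        (L (of_real_vec x + of_real t *s of_real_vec u) * exp (- (\<i> * of_real ?y) * of_real t))" for t x
    proof -
      have "cis (- (2 * pi * ((t *\<^sub>R u + x) \<bullet> \<xi>))) = cis (- (2 * pi * (x \<bullet> \<xi>))) * cis (- (?y * t))"
        by (simp add: cis_mult inner_add_left u algebra_simps)
      also have "cis (- (?y * t)) = exp (- (\<i> * of_real ?y) * of_real t)"
        by (simp add: cis_conv_exp mult.assoc)
      finally have "cis (- (2 * pi * ((t *\<^sub>R u + x) \<bullet> \<xi>)))
          = cis (- (2 * pi * (x \<bullet> \<xi>))) * exp (- (\<i> * of_real ?y) * of_real t)" .
      moreover have "of_real_vec (t *\<^sub>R u + x) = of_real_vec x + of_real t *s of_real_vec u"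
        by (simp add: of_real_vec_add of_real_vec_scaleR)
      ultimately show ?thesis
        by (simp only: mult_ac)
    qed
    have zero: "(LINT t|lborel. ?G (t *\<^sub>R u + x)) = 0" if "integrable lborel (\<lambda>t. ?G (t *\<^sub>R u + x))" for x
    proof -
      let ?f = "\<lambda>w. L (of_real_vec x + w *s of_real_vec u)"
      obtain C where C: "\<And>w. norm (?f w) \<le> C * exp (A * norm w)"
        using exponential_type_line[OF L A(1) A0 u(1)] by blast
      have hol: "?f holomorphic_on UNIV" by (rule entire_holomorphic_line[OF L(1)])
      have "continuous_on UNIV (\<lambda>t::real. ?f (of_real t))"
        by (rule continuous_on_compose2[OF holomorphic_on_imp_continuous_on[OF hol]])
           (auto intro!: continuous_intros)
      then have "(\<lambda>t::real. ?f (of_real t)) \<in> borel_measurable lborel"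
        by (simp add: borel_measurable_continuous_onI)
      then have "integrable lborel (\<lambda>t. ?f (of_real t))"
        by (rule Bochner_Integration.integrable_bound[OF that]) (simp add: line norm_mult)
      from paley_wiener_line[OF hol C A0 this A(2)] show ?thesis
        unfolding line by simp
    qed
    have "AE x in lborel. indicator {0..1} (x \<bullet> u) *\<^sub>R (LINT t|lborel. ?G (t *\<^sub>R u + x)) = 0"
      using integrable_along_lines[OF u(1) fourier_integrable[OF int, of \<xi>]]
    proof eventually_elim
      case (elim x)
      with zero[of x] show ?case by (cases "x \<bullet> u \<in> {0..1}") simp_all
    qed
    then show ?thesis
      unfolding fourier_def
      by (subst integral_along_lines[OF u(1) fourier_integrable[OF int]]) (rule integral_eq_zero_AE)
  qed
  \<comment> \<open>Points slightly outside the sphere through \<open>\<xi>\<close>, where the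
    strict case applies.\<close>
  define v where "v = (\<lambda>n. (1 + inverse (real (Suc n))) *\<^sub>R \<xi>)"
  have "v \<longlonglongrightarrow> (1 + 0) *\<^sub>R \<xi>"
    unfolding v_def by (intro tendsto_intros LIMSEQ_inverse_real_of_nat)
  then have "(\<lambda>n. fourier (\<lambda>x. L (of_real_vec x)) (v n)) \<longlonglongrightarrow> fourier (\<lambda>x. L (of_real_vec x)) \<xi>"
    by (intro fourier_tendsto[OF int]) simp
  moreover have "fourier (\<lambda>x. L (of_real_vec x)) (v n) = 0" for n
  proof (rule strict)
    have "1 * norm \<xi> < (1 + inverse (real (Suc n))) * norm \<xi>"
      using \<delta> by (intro mult_strict_right_mono) auto
    then show "\<delta> < norm (v n)" using \<delta> by (simp add: v_def)
  qed
  ultimately show ?thesis by (simp add: LIMSEQ_const_iff)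
qed

section \<open>The Fourier transform of the Gaussian\<close>

text \<open>Lebesgue measure is the image of the product of one-dimensional Lebesgue measures under
  the coordinate map, so functions with separated variables integrate factor by factor.\<close>

lemma
  fixes f :: "'a::euclidean_space \<Rightarrow> real \<Rightarrow> complex"
  assumes int: "\<And>b. b \<in> Basis \<Longrightarrow> integrable lborel (f b)"
  shows integrable_lborel_prod: "integrable lborel (\<lambda>x. \<Prod>b\<in>Basis. f b (x \<bullet> b))"
    and integral_lborel_prod:
      "(LINT x|lborel. (\<Prod>b\<in>Basis. f b (x \<bullet> b))) = (\<Prod>b\<in>Basis. LINT t|lborel. f b t)"
proof -
  interpret product_sigma_finite "\<lambda>b :: 'a. lborel :: real measure" by standard
  let ?P = "\<Pi>\<^sub>M b\<in>(Basis :: 'a set). (lborel :: real measure)"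
  let ?T = "\<lambda>x. \<Sum>b\<in>(Basis :: 'a set). x b *\<^sub>R b"
  have [measurable]: "f b \<in> borel_measurable borel" if "b \<in> Basis" for b
    using int[OF that] by auto
  have meas: "(\<lambda>x. \<Prod>b\<in>Basis. f b (x \<bullet> b)) \<in> borel_measurable borel" by measurable
  have T: "?T \<in> ?P \<rightarrow>\<^sub>M borel" by measurable
  have eq: "(\<Prod>b\<in>Basis. f b (?T x \<bullet> b)) = (\<Prod>b\<in>Basis. f b (x b))" for x
    by (intro prod.cong) auto
  show "integrable lborel (\<lambda>x. \<Prod>b\<in>Basis. f b (x \<bullet> b))"
    unfolding lborel_eq[where 'a = 'a] integrable_distr_eq[OF T meas] eq
    by (rule product_integrable_prod) (use int in auto)
  show "(LINT x|lborel. (\<Prod>b\<in>Basis. f b (x \<bullet> b))) = (\<Prod>b\<in>Basis. LINT t|lborel. f b t)"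
    unfolding lborel_eq[where 'a = 'a] integral_distr[OF T meas] eq
    by (rule product_integral_prod) (use int in auto)
qed

text \<open>Obtained from the characteristic function of the standard normal distribution by a
  linear substitution.\<close>

lemma
  fixes lam s :: real
  assumes lam: "lam > 0"
  shows integrable_gaussian_line: "integrable lborel (\<lambda>t. exp (- pi * lam * t\<^sup>2))"
    and fourier_gaussian_line:
      "(LINT t|lborel. of_real (exp (- pi * lam * t\<^sup>2)) * cis (- (2 * pi * (t * s))))
        = of_real (exp (- pi * s\<^sup>2 / lam) / sqrt lam)"
proof -
  \<comment> \<open>Chosen so that the exponent \<open>(c * t)\<^sup>2 / 2\<close> of the normal
    density becomes \<open>pi * lam * t\<^sup>2\<close>.\<close>
  define c where "c = sqrt (2 * pi * lam)"
  have c: "c > 0" "c\<^sup>2 = 2 * pi * lam" using lam by (auto simp: c_def)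
  have sc: "c / sqrt (2 * pi) = sqrt lam" by (simp add: c_def real_sqrt_mult)
  \<comment> \<open>The summand \<open>0\<close> fits the form of the affine substitution rules
    applied below.\<close>
  have dens: "std_normal_density (0 + c * t) = exp (- pi * lam * t\<^sup>2) / sqrt (2 * pi)" for t
    by (simp add: std_normal_density_def power_mult_distrib c)
  have "integrable lborel (\<lambda>t. std_normal_density (0 + c * t))"
    using c by (intro lborel_integrable_real_affine integrable_normal_density) auto
  from integrable_mult_left[OF this, of "sqrt (2 * pi)"]
  show "integrable lborel (\<lambda>t. exp (- pi * lam * t\<^sup>2))" unfolding dens by simp
  \<comment> \<open>Chosen so that \<open>r * (c * t)\<close> equals the phase
    \<open>- 2 * pi * (t * s)\<close>.\<close>
  define r where "r = - 2 * pi * s / c"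
  have "of_real (exp (- r\<^sup>2 / 2)) = char std_normal_distribution r"
    by (simp add: char_std_normal_distribution)
  also have "\<dots> = (LINT x|lborel. std_normal_density x *\<^sub>R iexp (r * x))"
    unfolding char_def by (subst integral_density) auto
  also have "\<dots> = \<bar>c\<bar> *\<^sub>R (LINT t|lborel. std_normal_density (0 + c * t) *\<^sub>R iexp (r * (0 + c * t)))"
    using c by (intro lborel_integral_real_affine) auto
  also have "(\<lambda>t. std_normal_density (0 + c * t) *\<^sub>R iexp (r * (0 + c * t)))
      = (\<lambda>t. of_real (1 / sqrt (2 * pi)) * (of_real (exp (- pi * lam * t\<^sup>2)) * cis (- (2 * pi * (t * s)))))"
    unfolding dens using c
    by (intro ext) (simp add: cis_conv_exp scaleR_conv_of_real r_def mult_ac)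
  also have "\<bar>c\<bar> *\<^sub>R (LINT t|lborel. of_real (1 / sqrt (2 * pi)) * (of_real (exp (- pi * lam * t\<^sup>2)) * cis (- (2 * pi * (t * s)))))
      = of_real (sqrt lam) * (LINT t|lborel. of_real (exp (- pi * lam * t\<^sup>2)) * cis (- (2 * pi * (t * s))))"
    unfolding sc[symmetric] using c by (simp add: scaleR_conv_of_real)
  finally have "of_real (sqrt lam) * (LINT t|lborel. of_real (exp (- pi * lam * t\<^sup>2)) * cis (- (2 * pi * (t * s))))
      = of_real (exp (- r\<^sup>2 / 2))" by simp
  moreover have "r\<^sup>2 / 2 = pi * s\<^sup>2 / lam"
    using lam by (simp add: r_def power_divide c power_mult_distrib) (simp add: field_simps power2_eq_square)
  ultimately show "(LINT t|lborel. of_real (exp (- pi * lam * t\<^sup>2)) * cis (- (2 * pi * (t * s))))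
        = of_real (exp (- pi * s\<^sup>2 / lam) / sqrt lam)"
    using lam by (simp add: field_simps)
qed

lemma
  fixes \<xi> :: "real ^ 'n"
  assumes lam: "lam > 0"
  shows integrable_gaussian: "integrable lborel (gaussian lam :: real ^ 'n \<Rightarrow> real)"
    and fourier_gaussian: "fourier (\<lambda>x. of_real (gaussian lam x)) \<xi>
      = of_real (lam powr (- real CARD('n) / 2) * exp (- pi * (norm \<xi>)\<^sup>2 / lam))"
proof -
  let ?k = "\<lambda>s t. complex_of_real (exp (- pi * lam * t\<^sup>2)) * cis (- (2 * pi * (t * s)))"
  have int: "integrable lborel (?k s)" for s
  proof (rule Bochner_Integration.integrable_bound[OF integrable_gaussian_line[OF lam]])
    have "continuous_on UNIV (?k s)" by (intro continuous_intros)
    then show "?k s \<in> borel_measurable lborel" by (simp add: borel_measurable_continuous_onI)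
  qed (auto simp: norm_mult)
  have norm2: "(norm x)\<^sup>2 = (\<Sum>b\<in>Basis. (x \<bullet> b)\<^sup>2)" for x :: "real ^ 'n"
    unfolding power2_norm_eq_inner euclidean_inner[of x x] by (simp add: power2_eq_square)
  have cis_sum: "cis (sum g S) = (\<Prod>b\<in>S. cis (g b))" if "finite S" for g and S :: "(real ^ 'n) set"
    using that by (induction) (auto simp: cis_mult[symmetric])
  have eq: "of_real (gaussian lam x) * cis (- (2 * pi * (x \<bullet> \<xi>))) = (\<Prod>b\<in>Basis. ?k (\<xi> \<bullet> b) (x \<bullet> b))" for x \<xi> :: "real ^ 'n"
  proof -
    have "gaussian lam x = (\<Prod>b\<in>Basis. exp (- pi * lam * (x \<bullet> b)\<^sup>2))"
      by (simp add: gaussian_def norm2 sum_distrib_left sum_negf[symmetric] exp_sum)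
    moreover have "cis (- (2 * pi * (x \<bullet> \<xi>))) = (\<Prod>b\<in>Basis. cis (- (2 * pi * ((x \<bullet> b) * (\<xi> \<bullet> b)))))"
      unfolding euclidean_inner[of x \<xi>]
      by (simp add: cis_sum[symmetric] sum_distrib_left sum_negf[symmetric])
    ultimately show ?thesis by (simp add: prod.distrib)
  qed
  \<comment> \<open>At frequency \<open>0\<close> the character is \<open>1\<close>, so the
    factorised integrand is the Gaussian itself.\<close>
  have "integrable lborel (\<lambda>x. of_real (gaussian lam x) * cis (- (2 * pi * (x \<bullet> (0 :: real ^ 'n)))))"
    unfolding eq by (intro integrable_lborel_prod int)
  then have "integrable lborel (\<lambda>x :: real ^ 'n. complex_of_real (gaussian lam x))"
    by simp
  then show "integrable lborel (gaussian lam :: real ^ 'n \<Rightarrow> real)"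
    by (simp only: complex_of_real_integrable_eq)
  have "fourier (\<lambda>x. of_real (gaussian lam x)) \<xi> = (\<Prod>b\<in>Basis. of_real (exp (- pi * (\<xi> \<bullet> b)\<^sup>2 / lam) / sqrt lam))"
    unfolding fourier_def eq by (subst integral_lborel_prod[OF int]) (simp only: fourier_gaussian_line[OF lam])
  also have "\<dots> = of_real (\<Prod>b\<in>(Basis :: (real ^ 'n) set). exp (- pi * (\<xi> \<bullet> b)\<^sup>2 / lam) / sqrt lam)"
    by simp
  also have "(\<Prod>b\<in>(Basis :: (real ^ 'n) set). exp (- pi * (\<xi> \<bullet> b)\<^sup>2 / lam) / sqrt lam)
      = exp (- pi * (norm \<xi>)\<^sup>2 / lam) / sqrt lam ^ CARD('n)"
    by (simp add: prod_dividef exp_sum[symmetric] norm2 sum_distrib_left sum_divide_distrib sum_negf)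
  also have "sqrt lam ^ CARD('n) = lam powr (real CARD('n) / 2)"
    using lam by (simp add: powr_half_sqrt[symmetric] powr_realpow[symmetric] powr_powr)
  finally show "fourier (\<lambda>x. of_real (gaussian lam x)) \<xi>
      = of_real (lam powr (- real CARD('n) / 2) * exp (- pi * (norm \<xi>)\<^sup>2 / lam))"
    using lam by (simp add: powr_minus divide_simps mult.commute)
qed

section \<open>The quadratic form\<close>

lemma fourier_diff:
  assumes "integrable lborel F" "integrable lborel G"
  shows "fourier (\<lambda>x. F x - G x) \<xi> = fourier F \<xi> - fourier G \<xi>"
  unfolding fourier_def left_diff_distrib
  by (intro Bochner_Integration.integral_diff fourier_integrable assms)

lemma fourier_mult_left: "fourier (\<lambda>x. c * F x) \<xi> = c * fourier F \<xi>"
  unfolding fourier_def mult.assoc by simp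

text \<open>The easy direction of Bochner's theorem: the double sum is the integral of
  \<open>F\<close> times the squared modulus of the trigonometric sum \<open>s\<close>.\<close>

lemma fourier_positive_definite:
  fixes F :: "'a::euclidean_space \<Rightarrow> real" and y :: "'i \<Rightarrow> 'a"
  assumes int: "integrable lborel F" and nonneg: "\<And>x. F x \<ge> 0"
  shows "0 \<le> Re (\<Sum>j\<in>I. \<Sum>l\<in>I. a j * cnj (a l) * fourier (\<lambda>x. of_real (F x)) (y j - y l))"
proof -
  define s where "s = (\<lambda>x. \<Sum>j\<in>I. a j * cis (- (2 * pi * (x \<bullet> y j))))"
  have intc: "integrable lborel (\<lambda>x. complex_of_real (F x))"
    using int by (simp only: complex_of_real_integrable_eq)
  have sq: "(\<Sum>j\<in>I. \<Sum>l\<in>I. a j * cnj (a l) * (of_real (F x) * cis (- (2 * pi * (x \<bullet> (y j - y l))))))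
      = of_real (F x * (norm (s x))\<^sup>2)" for x
  proof -
    have "cis (- (2 * pi * (x \<bullet> (y j - y l)))) = cis (- (2 * pi * (x \<bullet> y j))) * cnj (cis (- (2 * pi * (x \<bullet> y l))))" for j l
      by (simp add: cis_cnj cis_mult inner_diff_right algebra_simps)
    then have "(\<Sum>j\<in>I. \<Sum>l\<in>I. a j * cnj (a l) * (of_real (F x) * cis (- (2 * pi * (x \<bullet> (y j - y l))))))
        = of_real (F x) * (s x * cnj (s x))"
      unfolding s_def cnj_sum unfolding sum_product unfolding sum_distrib_left
      by (intro sum.cong refl) (simp only: complex_cnj_mult mult_ac)
    then show ?thesis by (simp add: complex_norm_square[symmetric])
  qed
  have "(\<Sum>j\<in>I. \<Sum>l\<in>I. a j * cnj (a l) * fourier (\<lambda>x. of_real (F x)) (y j - y l))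
      = (LINT x|lborel. (\<Sum>j\<in>I. \<Sum>l\<in>I. a j * cnj (a l) * (of_real (F x) * cis (- (2 * pi * (x \<bullet> (y j - y l)))))))"
    unfolding fourier_def
    by (simp only: Bochner_Integration.integral_sum Bochner_Integration.integrable_sum integrable_mult_right
        fourier_integrable[OF intc] integral_mult_right_zero)
  also have "\<dots> = of_real (LINT x|lborel. F x * (norm (s x))\<^sup>2)"
    unfolding sq by (rule integral_complex_of_real)
  finally show ?thesis
    using nonneg by (simp add: integral_nonneg_AE)
qed

text \<open>For \<open>lam > 0\<close> this is the Fourier transform of \<open>gaussian lam\<close>,
  and it is also the integrand of \<open>Q_kernel\<close>; this coincidence links the extremal
  problem to the quadratic form.\<close>

definition gaussian_kernel :: "real \<Rightarrow> real ^ 'n \<Rightarrow> real" where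
  "gaussian_kernel lam y = lam powr (- real CARD('n) / 2) * exp (- pi * (norm y)\<^sup>2 / lam)"

abbreviation off_diagonal :: "nat \<Rightarrow> (nat \<times> nat) set" where
  "off_diagonal M \<equiv> {(j, l). j \<in> {1..M} \<and> l \<in> {1..M} \<and> j \<noteq> l}"

text \<open>Real parts are taken termwise to have a real integrand. Nothing is lost, because the
  imaginary parts for \<open>(j, l)\<close> and \<open>(l, j)\<close> cancel.\<close>

definition gaussian_form :: "nat \<Rightarrow> (nat \<Rightarrow> complex) \<Rightarrow> (nat \<Rightarrow> real ^ 'n) \<Rightarrow> real \<Rightarrow> real" where
  "gaussian_form M a y lam =
     (\<Sum>(j, l) \<in> off_diagonal M. Re (a j * cnj (a l)) * gaussian_kernel lam (y j - y l))"

lemma finite_off_diagonal: "finite (off_diagonal M)"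
  by (rule finite_subset[of _ "{1..M} \<times> {1..M}"]) auto

lemma sum_square_split:
  fixes f :: "nat \<Rightarrow> nat \<Rightarrow> 'b::ab_group_add"
  shows "(\<Sum>j=1..M. \<Sum>l=1..M. f j l) = (\<Sum>j=1..M. f j j) + (\<Sum>(j, l) \<in> off_diagonal M. f j l)"
proof -
  let ?D = "(\<lambda>j. (j, j)) ` {1..M}"
  have split: "{1..M} \<times> {1..M} = ?D \<union> off_diagonal M" and disj: "?D \<inter> off_diagonal M = {}"
    by auto
  have "(\<Sum>(j, l) \<in> {1..M} \<times> {1..M}. f j l) = (\<Sum>(j, l) \<in> ?D. f j l) + (\<Sum>(j, l) \<in> off_diagonal M. f j l)"
    unfolding split by (rule sum.union_disjoint[OF _ finite_off_diagonal disj]) simp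
  also have "(\<Sum>(j, l) \<in> ?D. f j l) = (\<Sum>j=1..M. f j j)"
    by (subst sum.reindex) (auto simp: inj_on_def)
  finally show ?thesis by (simp add: sum.cartesian_product)
qed

text \<open>
  The sign \<open>\<sigma>\<close> is \<open>1\<close> for minorants and \<open>-1\<close> for majorants. If all \<open>a j\<close> vanish, the quotient
  is \<open>0\<close>.
\<close>

lemma one_sided_gaussian_bound:
  fixes H :: "complex ^ 'n \<Rightarrow> complex" and y :: "nat \<Rightarrow> real ^ 'n"
  assumes \<delta>: "\<delta> > 0" and lam: "lam > 0"
    and sep: "\<And>j l. j \<in> {1..M} \<Longrightarrow> l \<in> {1..M} \<Longrightarrow> j \<noteq> l \<Longrightarrow> \<delta> \<le> norm (y j - y l)"
    and H: "entire H" "exponential_type H \<le> ereal (2 * pi * \<delta>)" "\<And>x. H (of_real_vec x) \<in> \<real>"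
    and \<sigma>: "\<sigma> = 1 \<or> \<sigma> = - 1"
    and nonneg: "\<And>x. 0 \<le> \<sigma> * (gaussian lam x - Re (H (of_real_vec x)))"
  shows "ennreal (- \<sigma> * gaussian_form M a y lam / (\<Sum>j=1..M. (cmod (a j))\<^sup>2))
    \<le> (\<integral>\<^sup>+ x. ennreal (\<sigma> * (gaussian lam x - Re (H (of_real_vec x)))) \<partial>lborel)"
\<comment> \<open>An infinite integral makes the bound trivial. Otherwise \<open>F\<close> is
  integrable, and hence so is \<open>H\<close> on the real points.\<close>
proof (cases "(\<integral>\<^sup>+ x. ennreal (\<sigma> * (gaussian lam x - Re (H (of_real_vec x)))) \<partial>lborel) = \<infinity>")
  case False
  define F where "F = (\<lambda>x. \<sigma> * (gaussian lam x - Re (H (of_real_vec x))))"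
  define S where "S = (\<Sum>j=1..M. (cmod (a j))\<^sup>2)"
  have \<sigma>\<sigma>: "\<sigma> * \<sigma> = 1" using \<sigma> by auto
  have contH: "continuous_on UNIV (\<lambda>x. H (of_real_vec x))"
    by (rule continuous_on_compose2[OF entire_imp_continuous[OF H(1)] continuous_of_real_vec]) auto
  have [measurable]: "(\<lambda>x. H (of_real_vec x)) \<in> borel_measurable borel"
    using contH by (rule borel_measurable_continuous_onI)
  have gint: "integrable lborel (gaussian lam :: real ^ 'n \<Rightarrow> real)" by (rule integrable_gaussian[OF lam])
  then have [measurable]: "(gaussian lam :: real ^ 'n \<Rightarrow> real) \<in> borel_measurable borel" by auto
  have [measurable]: "F \<in> borel_measurable borel" unfolding F_def by measurable
  have F0: "F x \<ge> 0" for x using nonneg by (simp add: F_def)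
  have Fint: "integrable lborel F"
    by (rule integrableI_nonneg) (use F0 False in \<open>auto simp: F_def top.not_eq_extremum\<close>)
  have Hre: "H (of_real_vec x) = of_real (Re (H (of_real_vec x)))" for x
    using H(3) by (simp add: of_real_Re)
  have HF: "H (of_real_vec x) = of_real (gaussian lam x) - of_real \<sigma> * of_real (F x)" for x
  proof -
    have "Re (H (of_real_vec x)) = gaussian lam x - (\<sigma> * \<sigma>) * (gaussian lam x - Re (H (of_real_vec x)))"
      unfolding \<sigma>\<sigma> by simp
    also have "\<dots> = gaussian lam x - \<sigma> * F x" unfolding F_def by (simp only: mult.assoc)
    finally show ?thesis by (subst Hre) simp
  qed
  have gint': "integrable lborel (\<lambda>x :: real ^ 'n. complex_of_real (gaussian lam x))"
    and Fint': "integrable lborel (\<lambda>x. complex_of_real (F x))"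
    using gint Fint by (simp_all only: complex_of_real_integrable_eq)
  have Fint'': "integrable lborel (\<lambda>x. complex_of_real \<sigma> * complex_of_real (F x))"
    using Fint' by (rule integrable_mult_right)
  have Hint: "integrable lborel (\<lambda>x. H (of_real_vec x))"
    unfolding HF using gint' Fint'' by (rule Bochner_Integration.integrable_diff)
  have FF: "fourier (\<lambda>x. of_real (F x)) \<xi> = of_real (\<sigma> * gaussian_kernel lam \<xi>)" if "\<delta> \<le> norm \<xi>" for \<xi>
  proof -
    have "0 = fourier (\<lambda>x. H (of_real_vec x)) \<xi>"
      by (rule paley_wiener[OF H(1,2) Hint \<delta> that, symmetric])
    also have "\<dots> = fourier (\<lambda>x. of_real (gaussian lam x)) \<xi> - of_real \<sigma> * fourier (\<lambda>x. of_real (F x)) \<xi>"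
      unfolding HF fourier_diff[OF gint' Fint''] fourier_mult_left ..
    finally have "of_real \<sigma> * fourier (\<lambda>x. of_real (F x)) \<xi> = of_real (gaussian_kernel lam \<xi>)"
      unfolding fourier_gaussian[OF lam] gaussian_kernel_def by simp
    then have "of_real (\<sigma> * \<sigma>) * fourier (\<lambda>x. of_real (F x)) \<xi> = of_real (\<sigma> * gaussian_kernel lam \<xi>)"
      by (simp add: mult.assoc)
    then show ?thesis unfolding \<sigma>\<sigma> by simp
  qed
  have F00: "fourier (\<lambda>x. of_real (F x)) 0 = of_real (LINT x|lborel. F x)"
    unfolding fourier_def by simp
  have "0 \<le> Re (\<Sum>j=1..M. \<Sum>l=1..M. a j * cnj (a l) * fourier (\<lambda>x. of_real (F x)) (y j - y l))"
    by (rule fourier_positive_definite[OF Fint F0])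
  also have "\<dots> = (\<Sum>j=1..M. Re (a j * cnj (a j) * fourier (\<lambda>x. of_real (F x)) 0))
      + (\<Sum>(j, l) \<in> off_diagonal M. Re (a j * cnj (a l) * fourier (\<lambda>x. of_real (F x)) (y j - y l)))"
    unfolding sum_square_split by (simp add: case_prod_unfold)
  also have "(\<Sum>j=1..M. Re (a j * cnj (a j) * fourier (\<lambda>x. of_real (F x)) 0)) = (LINT x|lborel. F x) * S"
    unfolding F00 S_def complex_norm_square[symmetric] by (simp add: sum_distrib_left mult.commute)
  also have "(\<Sum>(j, l) \<in> off_diagonal M. Re (a j * cnj (a l) * fourier (\<lambda>x. of_real (F x)) (y j - y l)))
      = (\<Sum>(j, l) \<in> off_diagonal M. \<sigma> * (Re (a j * cnj (a l)) * gaussian_kernel lam (y j - y l)))"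
  proof (intro sum.cong refl, clarify)
    fix j l assume "j \<in> {1..M}" "l \<in> {1..M}" "j \<noteq> l"
    then show "Re (a j * cnj (a l) * fourier (\<lambda>x. of_real (F x)) (y j - y l))
        = \<sigma> * (Re (a j * cnj (a l)) * gaussian_kernel lam (y j - y l))"
      using FF[OF sep] by (simp add: algebra_simps)
  qed
  also have "\<dots> = \<sigma> * gaussian_form M a y lam"
    by (simp add: gaussian_form_def sum_distrib_left case_prod_unfold)
  finally have main: "- \<sigma> * gaussian_form M a y lam \<le> (LINT x|lborel. F x) * S" by simp
  have "- \<sigma> * gaussian_form M a y lam / S \<le> (LINT x|lborel. F x)"
  proof (cases "S = 0")
    case True
    then show ?thesis using F0 by (simp add: integral_nonneg_AE)
  next
    case False
    moreover have "S \<ge> 0" unfolding S_def by (intro sum_nonneg) auto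
    ultimately have "S > 0" by simp
    then show ?thesis using main by (simp only: pos_divide_le_eq)
  qed
  then have "ennreal (- \<sigma> * gaussian_form M a y lam / S) \<le> ennreal (LINT x|lborel. F x)"
    by (rule ennreal_leI)
  also have "\<dots> = (\<integral>\<^sup>+ x. ennreal (F x) \<partial>lborel)"
    using Fint F0 by (simp add: nn_integral_eq_integral)
  finally show ?thesis by (simp add: F_def S_def)
qed simp

section \<open>Integration over the Gaussian parameter\<close>

lemma powr_exp_bounded:
  fixes p c :: real
  assumes p: "p \<ge> 0" and c: "c > 0"
  shows "\<exists>K. \<forall>u>0. u powr (- p) * exp (- c / u) \<le> K"
proof (cases "p = 0")
  case True
  then show ?thesis using c by (intro exI[of _ 1]) auto
next
  case False
  with p have p: "p > 0" by simp
  show ?thesis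
  proof (intro exI allI impI)
    fix u :: real assume u: "u > 0"
    \<comment> \<open>The function is largest at \<open>u = c / p\<close>. The inequality
      \<open>ln t \<le> t - 1\<close> at \<open>t = c / (p * u)\<close> is an equality there, so the
      bound found is the maximum.\<close>
    have "ln (c / (p * u)) \<le> c / (p * u) - 1"
      using u p c by (intro ln_le_minus_one) auto
    then have "p * ln (c / (p * u)) \<le> p * (c / (p * u) - 1)"
      using p by (intro mult_left_mono) auto
    also have "\<dots> = c / u - p" using p u by (simp add: field_simps)
    also have "ln (c / (p * u)) = ln (c / p) - ln u" using u p c by (simp add: ln_div ln_mult)
    finally have "- p * ln u - c / u \<le> - p - p * ln (c / p)" by (simp add: algebra_simps)
    then show "u powr (- p) * exp (- c / u) \<le> exp (- p - p * ln (c / p))"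
      using u by (simp add: powr_def exp_add[symmetric])
  qed
qed

text \<open>\<open>U\<close> may be infinite and \<open>S\<close> may be \<open>0\<close>. Since the
  product of infinity and \<open>0\<close> is \<open>0\<close> in the extended reals, the case
  \<open>S = 0\<close> needs its own hypothesis on \<open>c\<close>.\<close>

lemma ereal_le_enn2ereal_times:
  assumes "ennreal (c / S) \<le> U" "S \<ge> 0" "S = 0 \<Longrightarrow> c \<le> 0"
  shows "ereal c \<le> enn2ereal U * ereal S"
proof (cases "S = 0")
  case True
  then show ?thesis using assms(3) by (simp add: zero_ereal_def[symmetric])
next
  case False
  with assms have S: "S > 0" by simp
  show ?thesis
  proof (cases U)
    case (real r)
    then have "c / S \<le> r" using assms(1) by (auto simp: ennreal_le_iff2)
    then show ?thesis using S real by (simp add: enn2ereal_ennreal divide_le_eq)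
  next
    case top
    then show ?thesis using S by (simp add: top_ereal_def)
  qed
qed

text \<open>\<open>f\<close> may change sign: \<open>ennreal\<close> sends negative values to
  \<open>0\<close>, so the right-hand side integrates only the positive part.\<close>

lemma ennreal_integral_le:
  assumes "integrable M f"
  shows "ennreal (integral\<^sup>L M f) \<le> (\<integral>\<^sup>+ x. ennreal (f x) \<partial>M)"
proof -
  have "integral\<^sup>L M f \<le> (LINT x|M. max 0 (f x))"
    using assms by (intro integral_mono) auto
  then have "ennreal (integral\<^sup>L M f) \<le> ennreal (LINT x|M. max 0 (f x))" by (rule ennreal_leI)
  also have "\<dots> = (\<integral>\<^sup>+ x. ennreal (max 0 (f x)) \<partial>M)"
    using assms by (intro nn_integral_eq_integral[symmetric]) auto
  also have "\<dots> = (\<integral>\<^sup>+ x. ennreal (f x) \<partial>M)"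
    by (intro nn_integral_cong) (simp add: max_def ennreal_neg)
  finally show ?thesis .
qed

text \<open>Exchanging the indices conjugates the coefficients and leaves the even kernel
  unchanged.\<close>

lemma off_diagonal_form_real: "off_diagonal_form \<mu> M a y \<in> \<real>"
proof -
  have "cnj (off_diagonal_form \<mu> M a y) = (\<Sum>(j, l) \<in> off_diagonal M. a l * cnj (a j) * of_real (Q_kernel \<mu> (y j - y l)))"
    unfolding off_diagonal_form_def cnj_sum by (intro sum.cong) (auto simp: mult_ac)
  also have "\<dots> = off_diagonal_form \<mu> M a y"
    unfolding off_diagonal_form_def
    by (rule sum.reindex_bij_witness[of _ prod.swap prod.swap]) (auto simp: Q_kernel_def norm_minus_commute)
  finally show ?thesis by (simp add: Reals_cnj_iff)
qed

lemma off_diagonal_form_eq_integral: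
  assumes int: "\<And>j l. j \<in> {1..M} \<Longrightarrow> l \<in> {1..M} \<Longrightarrow> j \<noteq> l \<Longrightarrow>
      integrable \<mu> (\<lambda>lam. gaussian_kernel lam (y j - y l))"
  shows "integrable \<mu> (gaussian_form M a y)"
    and "Re (off_diagonal_form \<mu> M a y) = (LINT lam|\<mu>. gaussian_form M a y lam)"
proof -
  have int': "integrable \<mu> (\<lambda>lam. case p of (j, l) \<Rightarrow> Re (a j * cnj (a l)) * gaussian_kernel lam (y j - y l))"
    if "p \<in> off_diagonal M" for p
    using that int by (auto intro!: integrable_mult_right simp del: times_complex.simps)
  show "integrable \<mu> (gaussian_form M a y)"
    unfolding gaussian_form_def[abs_def] by (intro Bochner_Integration.integrable_sum int')
  have "(LINT lam|\<mu>. gaussian_form M a y lam)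
      = (\<Sum>p \<in> off_diagonal M. LINT lam|\<mu>. (case p of (j, l) \<Rightarrow> Re (a j * cnj (a l)) * gaussian_kernel lam (y j - y l)))"
    unfolding gaussian_form_def by (intro Bochner_Integration.integral_sum int')
  also have "\<dots> = Re (off_diagonal_form \<mu> M a y)"
    unfolding off_diagonal_form_def Re_sum
  proof (intro sum.cong refl, clarify)
    fix j l
    have "Q_kernel \<mu> (y j - y l) = (LINT lam|\<mu>. gaussian_kernel lam (y j - y l))"
      by (simp add: Q_kernel_def gaussian_kernel_def)
    moreover have "Re (z * of_real r) = Re z * r" for z r by simp
    ultimately show "(LINT lam|\<mu>. Re (a j * cnj (a l)) * gaussian_kernel lam (y j - y l))
        = Re (a j * cnj (a l) * of_real (Q_kernel \<mu> (y j - y l)))"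
      by (simp only: integral_mult_right_zero)
  qed
  finally show "Re (off_diagonal_form \<mu> M a y) = (LINT lam|\<mu>. gaussian_form M a y lam)" ..
qed

lemma space_of_restrict_borel:
  assumes "sets \<mu> = sets (restrict_space borel {0<..})"
  shows "space \<mu> = {0 :: real<..}"
  using sets_eq_imp_space_eq[OF assms] by (simp add: space_restrict_space)

lemma gaussian_kernel_measurable:
  assumes "sets \<mu> = sets (restrict_space borel {0<..})"
  shows "(\<lambda>lam. gaussian_kernel lam y) \<in> borel_measurable \<mu>"
proof -
  have "(\<lambda>lam. gaussian_kernel lam y) \<in> borel_measurable borel"
    unfolding gaussian_kernel_def by measurable
  then show ?thesis
    unfolding measurable_cong_sets[OF assms refl] by (rule measurable_restrict_space1)
qed

lemma gaussian_kernel_integrable: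
  fixes y :: "real ^ 'n"
  assumes sets: "sets \<mu> = sets (restrict_space borel {0<..})"
    and meas: "w \<in> borel_measurable borel"
    and fin: "(\<integral>\<^sup>+ lam. ennreal (w lam) \<partial>\<mu>) < \<infinity>"
    and le: "\<And>lam. lam > 0 \<Longrightarrow> gaussian_kernel lam y \<le> C * w lam"
    and w: "\<And>lam. lam > 0 \<Longrightarrow> 0 \<le> w lam"
  shows "integrable \<mu> (\<lambda>lam. gaussian_kernel lam y)"
proof -
  note space = space_of_restrict_borel[OF sets]
  have wm: "w \<in> borel_measurable \<mu>"
    unfolding measurable_cong_sets[OF sets refl] by (rule measurable_restrict_space1[OF meas])
  have "integrable \<mu> w"
    using wm fin w by (intro integrableI_nonneg) (auto intro!: AE_I2 simp: space)
  then have "integrable \<mu> (\<lambda>lam. C * w lam)" by (rule integrable_mult_right)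
  then show ?thesis
  proof (rule Bochner_Integration.integrable_bound)
    show "AE lam in \<mu>. norm (gaussian_kernel lam y) \<le> norm (C * w lam)"
    proof (rule AE_I2)
      fix lam assume "lam \<in> space \<mu>"
      then have "gaussian_kernel lam y \<le> C * w lam" using le by (simp add: space)
      moreover have "gaussian_kernel lam y \<ge> 0" by (simp add: gaussian_kernel_def)
      ultimately show "norm (gaussian_kernel lam y) \<le> norm (C * w lam)" by simp
    qed
  qed (rule gaussian_kernel_measurable[OF sets])
qed

text \<open>Near \<open>0\<close> the exponential factor beats every power of \<open>lam\<close>. At
  infinity the kernel decays like \<open>lam powr (- (\<nu> + 1))\<close>, just as the first weight
  does, while the second weight stays away from \<open>0\<close>.\<close>

lemma gaussian_kernel_bound:
  fixes k :: nat and v :: "real ^ 'n"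
  assumes "v \<noteq> 0" and \<nu>: "2 * \<nu> + 2 = real CARD('n)"
  shows "\<exists>C. \<forall>lam>0. gaussian_kernel lam v \<le> C * (lam ^ k / (1 + lam powr (\<nu> + real k + 1)))"
    and "\<exists>C. \<forall>lam>0. gaussian_kernel lam v \<le> C * (lam ^ k / (1 + lam ^ k))"
proof -
  define c where "c = pi * (norm v)\<^sup>2"
  have c: "c > 0" using assms(1) by (simp add: c_def)
  have N: "real CARD('n) = 2 * \<nu> + 2" using \<nu> by simp
  then have n: "\<nu> + 1 \<ge> 0" using of_nat_0_le_iff[of "CARD('n)"] by (simp del: of_nat_0_le_iff)
  have "- real CARD('n) / 2 = - (\<nu> + 1)" unfolding N by simp
  then have ker: "gaussian_kernel lam v = lam powr (- (\<nu> + 1)) * exp (- c / lam)" for lam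
    unfolding gaussian_kernel_def by (simp add: c_def)
  \<comment> \<open>After clearing denominators, \<open>K2\<close> handles the summand
    \<open>1\<close> in both of them, \<open>K0\<close> the power of \<open>lam\<close> in the first
    and \<open>K1\<close> that in the second.\<close>
  obtain K0 where K0: "\<And>u. u > 0 \<Longrightarrow> u powr (- 0) * exp (- c / u) \<le> K0"
    using powr_exp_bounded[of 0 c] c by auto
  obtain K1 where K1: "\<And>u. u > 0 \<Longrightarrow> u powr (- (\<nu> + 1)) * exp (- c / u) \<le> K1"
    using powr_exp_bounded[OF n c] by auto
  obtain K2 where K2: "\<And>u. u > 0 \<Longrightarrow> u powr (- (\<nu> + 1 + real k)) * exp (- c / u) \<le> K2"
    using powr_exp_bounded[of "\<nu> + 1 + real k" c] n c by auto
  have pk: "lam ^ k = lam powr real k" if "lam > 0" for lam :: real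
    using that by (simp add: powr_realpow)
  have "gaussian_kernel lam v \<le> (K2 + K0) * (lam ^ k / (1 + lam powr (\<nu> + real k + 1)))" if "lam > 0" for lam
  proof -
    have pos: "1 + lam powr (\<nu> + real k + 1) > 0" by (smt (verit) powr_ge_zero)
    have "gaussian_kernel lam v * (1 + lam powr (\<nu> + real k + 1))
        = (lam powr (- (\<nu> + 1 + real k)) * exp (- c / lam) + lam powr (- 0) * exp (- c / lam)) * lam powr real k"
      unfolding ker using that by (simp add: algebra_simps powr_add[symmetric])
    also have "\<dots> \<le> (K2 + K0) * lam powr real k"
      by (intro mult_right_mono add_mono K0 K2 that) simp
    finally show ?thesis using pos that by (simp add: pk pos_le_divide_eq)
  qed
  then show "\<exists>C. \<forall>lam>0. gaussian_kernel lam v \<le> C * (lam ^ k / (1 + lam powr (\<nu> + real k + 1)))"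
    by blast
  have "gaussian_kernel lam v \<le> (K2 + K1) * (lam ^ k / (1 + lam ^ k))" if "lam > 0" for lam
  proof -
    have pos: "1 + lam powr real k > 0" by (smt (verit) powr_ge_zero)
    have shift: "lam powr (- (\<nu> + 1 + real k)) * lam powr real k = lam powr (- (\<nu> + 1))"
      by (simp add: powr_add[symmetric])
    have "gaussian_kernel lam v * (1 + lam powr real k)
        = (lam powr (- (\<nu> + 1 + real k)) * exp (- c / lam) + lam powr (- (\<nu> + 1)) * exp (- c / lam)) * lam powr real k"
      unfolding ker shift[symmetric] by (simp only: ring_distribs mult_1_right mult_ac add_ac)
    also have "\<dots> \<le> (K2 + K1) * lam powr real k"
      by (intro mult_right_mono add_mono K1 K2 that) simp
    finally show ?thesis using pos that by (simp add: pk pos_le_divide_eq)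
  qed
  then show "\<exists>C. \<forall>lam>0. gaussian_kernel lam v \<le> C * (lam ^ k / (1 + lam ^ k))"
    by blast
qed

text \<open>In the dimension fixed by \<open>\<nu>\<close> the weight is constantly
  \<open>1\<close>, so the bound for each single minorant is already a bound for the integrals in
  the infimum.\<close>

lemma U_minus_bound:
  fixes y :: "nat \<Rightarrow> real ^ 'n"
  assumes \<delta>: "\<delta> > 0" and \<nu>: "2 * \<nu> + 2 = real CARD('n)"
    and sep: "\<And>j l. j \<in> {1..M} \<Longrightarrow> l \<in> {1..M} \<Longrightarrow> j \<noteq> l \<Longrightarrow> \<delta> \<le> norm (y j - y l)"
    and lam: "lam > 0"
  shows "ennreal (- gaussian_form M a y lam / (\<Sum>j=1..M. (cmod (a j))\<^sup>2))
    \<le> U_minus TYPE('n) \<nu> (2 * pi * \<delta>) lam"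
  unfolding U_minus_def
proof (rule INF_greatest)
  fix L :: "complex ^ 'n \<Rightarrow> complex"
  assume "L \<in> minorants (2 * pi * \<delta>) lam"
  then show "ennreal (- gaussian_form M a y lam / (\<Sum>j=1..M. (cmod (a j))\<^sup>2))
      \<le> (\<integral>\<^sup>+ x. ennreal ((gaussian lam x - Re (L (of_real_vec x))) * weight \<nu> x) \<partial>lborel)"
    using one_sided_gaussian_bound[of \<delta> lam M y L 1 a] \<delta> lam sep
    by (simp add: minorants_def weight_def \<nu>)
qed

lemma U_plus_bound:
  fixes y :: "nat \<Rightarrow> real ^ 'n"
  assumes \<delta>: "\<delta> > 0" and \<nu>: "2 * \<nu> + 2 = real CARD('n)"
    and sep: "\<And>j l. j \<in> {1..M} \<Longrightarrow> l \<in> {1..M} \<Longrightarrow> j \<noteq> l \<Longrightarrow> \<delta> \<le> norm (y j - y l)"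
    and lam: "lam > 0"
  shows "ennreal (gaussian_form M a y lam / (\<Sum>j=1..M. (cmod (a j))\<^sup>2))
    \<le> U_plus TYPE('n) \<nu> (2 * pi * \<delta>) lam"
  unfolding U_plus_def
proof (rule INF_greatest)
  fix L :: "complex ^ 'n \<Rightarrow> complex"
  assume "L \<in> majorants (2 * pi * \<delta>) lam"
  then show "ennreal (gaussian_form M a y lam / (\<Sum>j=1..M. (cmod (a j))\<^sup>2))
      \<le> (\<integral>\<^sup>+ x. ennreal ((Re (L (of_real_vec x)) - gaussian lam x) * weight \<nu> x) \<partial>lborel)"
    using one_sided_gaussian_bound[of \<delta> lam M y L "-1" a] \<delta> lam sep
    by (simp add: majorants_def weight_def \<nu>)
qed

text \<open>
  \<open>U\<close> need not be measurable: the pointwise bound passes to the lower integral.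
\<close>

lemma off_diagonal_form_le:
  assumes sets: "sets \<mu> = sets (restrict_space borel {0<..})"
    and int: "integrable \<mu> (gaussian_form M a y)"
    and eq: "Re (off_diagonal_form \<mu> M a y) = (LINT lam|\<mu>. gaussian_form M a y lam)"
    and le: "\<And>lam. lam > 0 \<Longrightarrow>
      ennreal (s * gaussian_form M a y lam / (\<Sum>j=1..M. (cmod (a j))\<^sup>2)) \<le> U lam"
  shows "ereal (s * Re (off_diagonal_form \<mu> M a y))
    \<le> enn2ereal (\<integral>\<^sup>+ lam. U lam \<partial>\<mu>) * ereal (\<Sum>j=1..M. (cmod (a j))\<^sup>2)"
proof (rule ereal_le_enn2ereal_times)
  let ?S = "\<Sum>j=1..M. (cmod (a j))\<^sup>2"
  have "s * Re (off_diagonal_form \<mu> M a y) / ?S = (LINT lam|\<mu>. s * gaussian_form M a y lam / ?S)"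
    unfolding eq by simp
  then have "ennreal (s * Re (off_diagonal_form \<mu> M a y) / ?S)
      = ennreal (LINT lam|\<mu>. s * gaussian_form M a y lam / ?S)"
    by (rule arg_cong)
  also have "\<dots> \<le> (\<integral>\<^sup>+ lam. ennreal (s * gaussian_form M a y lam / ?S) \<partial>\<mu>)"
    using int by (intro ennreal_integral_le integrable_divide integrable_mult_right)
  also have "\<dots> \<le> (\<integral>\<^sup>+ lam. U lam \<partial>\<mu>)"
    by (intro nn_integral_mono le) (simp add: space_of_restrict_borel[OF sets])
  finally show "ennreal (s * Re (off_diagonal_form \<mu> M a y) / ?S) \<le> (\<integral>\<^sup>+ lam. U lam \<partial>\<mu>)" .
  show "s * Re (off_diagonal_form \<mu> M a y) \<le> 0" if "?S = 0"
  proof -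
    have "a j = 0" if "j \<in> {1..M}" for j
      using \<open>?S = 0\<close> that by (simp add: sum_nonneg_eq_0_iff)
    then have "off_diagonal_form \<mu> M a y = 0"
      unfolding off_diagonal_form_def by (intro sum.neutral) auto
    then show ?thesis by simp
  qed
qed (simp add: sum_nonneg)

text \<open>The disjunction of both growth conditions lets one integrability fact serve both halves
  of the theorem.\<close>

lemma gaussian_kernel_integrable_growth:
  fixes v :: "real ^ 'n"
  assumes sets: "sets \<mu> = sets (restrict_space borel {0<..})" and v: "v \<noteq> 0"
    and \<nu>: "2 * \<nu> + 2 = real CARD('n)"
    and fin: "(\<exists>k::nat. (\<integral>\<^sup>+ lam. ennreal (lam ^ k / (1 + lam powr (\<nu> + real k + 1))) \<partial>\<mu>) < \<infinity>)
      \<or> (\<exists>k::nat. (\<integral>\<^sup>+ lam. ennreal (lam ^ k / (1 + lam ^ k)) \<partial>\<mu>) < \<infinity>)"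
  shows "integrable \<mu> (\<lambda>lam. gaussian_kernel lam v)"
proof -
  note kb = gaussian_kernel_bound[OF v \<nu>]
  from fin show ?thesis
  proof (elim disjE exE)
    fix k :: nat
    assume fin: "(\<integral>\<^sup>+ lam. ennreal (lam ^ k / (1 + lam powr (\<nu> + real k + 1))) \<partial>\<mu>) < \<infinity>"
    obtain C where C: "\<And>lam. lam > 0 \<Longrightarrow> gaussian_kernel lam v \<le> C * (lam ^ k / (1 + lam powr (\<nu> + real k + 1)))"
      using kb(1)[of k] by blast
    show ?thesis
      by (rule gaussian_kernel_integrable[OF sets _ fin C]) auto
  next
    fix k :: nat
    assume fin: "(\<integral>\<^sup>+ lam. ennreal (lam ^ k / (1 + lam ^ k)) \<partial>\<mu>) < \<infinity>"
    obtain C where C: "\<And>lam. lam > 0 \<Longrightarrow> gaussian_kernel lam v \<le> C * (lam ^ k / (1 + lam ^ k))"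
      using kb(2)[of k] by blast
    show ?thesis
      by (rule gaussian_kernel_integrable[OF sets _ fin C]) auto
  qed
qed

theorem theorem16:
  fixes \<delta> \<nu> :: real and M :: nat and a :: "nat \<Rightarrow> complex" and y :: "nat \<Rightarrow> real ^ 'n"
    and \<mu> :: "real measure"
  assumes "\<delta> > 0"
    and "2 * \<nu> + 2 = real CARD('n)"
    and "\<And>j l. j \<in> {1..M} \<Longrightarrow> l \<in> {1..M} \<Longrightarrow> j \<noteq> l \<Longrightarrow> \<delta> \<le> norm (y j - y l)"
    and "sets \<mu> = sets (restrict_space borel {0<..})"
  shows
    "((\<exists>k::nat. (\<integral>\<^sup>+ lam. ennreal (lam ^ k / (1 + lam powr (\<nu> + real k + 1))) \<partial>\<mu>) < \<infinity>) \<longrightarrow>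
        off_diagonal_form \<mu> M a y \<in> \<real> \<and>
        - enn2ereal (U_minus_measure TYPE('n) \<nu> (2 * pi * \<delta>) \<mu>) * ereal (\<Sum>j=1..M. (cmod (a j))\<^sup>2)
          \<le> ereal (Re (off_diagonal_form \<mu> M a y)))
     \<and>
     ((\<exists>k::nat. (\<integral>\<^sup>+ lam. ennreal (lam ^ k / (1 + lam ^ k)) \<partial>\<mu>) < \<infinity>) \<longrightarrow>
        off_diagonal_form \<mu> M a y \<in> \<real> \<and>
        ereal (Re (off_diagonal_form \<mu> M a y))
          \<le> enn2ereal (U_plus_measure TYPE('n) \<nu> (2 * pi * \<delta>) \<mu>) * ereal (\<Sum>j=1..M. (cmod (a j))\<^sup>2))"
proof (intro conjI impI)
  \<comment> \<open>Separation keeps the differences off \<open>0\<close>, where the kernel has no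
    exponential decay as \<open>lam\<close> tends to \<open>0\<close>.\<close>
  have ne: "y j - y l \<noteq> 0" if "j \<in> {1..M}" "l \<in> {1..M}" "j \<noteq> l" for j l
    using assms(3)[OF that] assms(1) by auto
  note form = off_diagonal_form_eq_integral[OF gaussian_kernel_integrable_growth[OF assms(4) ne assms(2)]]
  let ?S = "\<Sum>j=1..M. (cmod (a j))\<^sup>2" and ?R = "Re (off_diagonal_form \<mu> M a y)"
  {
    assume fin: "\<exists>k::nat. (\<integral>\<^sup>+ lam. ennreal (lam ^ k / (1 + lam powr (\<nu> + real k + 1))) \<partial>\<mu>) < \<infinity>"
    \<comment> \<open>The factor \<open>- 1\<close> instantiates the sign \<open>s\<close>:
      minorants bound the negative of the form from above.\<close>
    have "ereal (- 1 * ?R) \<le> enn2ereal (U_minus_measure TYPE('n) \<nu> (2 * pi * \<delta>) \<mu>) * ereal ?S"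
      unfolding U_minus_measure_def
      using U_minus_bound[OF assms(1-3)] fin
      by (intro off_diagonal_form_le[OF assms(4)] form) auto
    then show "- enn2ereal (U_minus_measure TYPE('n) \<nu> (2 * pi * \<delta>) \<mu>) * ereal ?S \<le> ereal ?R"
      by (simp add: ereal_uminus_le_reorder)
  next
    assume fin: "\<exists>k::nat. (\<integral>\<^sup>+ lam. ennreal (lam ^ k / (1 + lam ^ k)) \<partial>\<mu>) < \<infinity>"
    have "ereal (1 * ?R) \<le> enn2ereal (U_plus_measure TYPE('n) \<nu> (2 * pi * \<delta>) \<mu>) * ereal ?S"
      unfolding U_plus_measure_def
      using U_plus_bound[OF assms(1-3)] fin
      by (intro off_diagonal_form_le[OF assms(4)] form) auto
    then show "ereal ?R \<le> enn2ereal (U_plus_measure TYPE('n) \<nu> (2 * pi * \<delta>) \<mu>) * ereal ?S"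
      by simp
  }
qed (rule off_diagonal_form_real)+

end
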